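(* Let $d\ge 1$ and let $\mu$ be the measure on $\mathbb{R}^d$ with density $W^H(x)=e^{-(x_1^2+\cdots+x_d^2)}$ with respect to Lebesgue measure, and let $(\Omega_n)_n$, $(\alpha_{\cdot|n})_n$ be its Jacobi sequences. Then for every $n\in\mathbb{N}$ one has $\alpha_{\cdot|n}\equiv 0$, and the coefficients $\lambda_{\overline{i}_n,\overline{j}_n}$ of $\Omega_n$ in the basis $(e_{\overline{i}_n})_{\overline{i}_n\in\mathcal{A}_n}$ of $(\mathbb{C}^d)^{\hat\otimes n}$ are given by $$\lambda_{\overline{i}_n,\overline{j}_n}=\delta_{\overline{i}_n,\overline{j}_n}\Big(\frac12\Big)^{|\overline{n}|}\pi^{d/2}\,\overline{n}!$$ where $\overline{i}_n=cl\big((i_1,\dots,i_n)\big)$, $\overline{j}_n=cl\big((j_1,\dots,j_n)\big)$, $n_l=\sharp\{k\in\{1,\dots,n\}: i_k=l\}$ for $1\le l\le d$, $\overline{n}=(n_1,\dots,n_d)$, $|\overline n|=n_1+\cdots+n_d$ and $\overline{n}!=n_1!\cdots n_d!$.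
   Context: $\mathbb{N}=\{0,1,2,\dots\}$. Let $\mathcal{P}=\mathbb{C}[X_1,\dots,X_d]$, and let $\mathcal{P}_{n]}$ be the polynomials of degree at most $n$, $\mathcal{P}_{-1]}=\{0\}$. Let $\langle P,Q\rangle_\mu=\int\overline{P}\,Q\,d\mu$. Let $\mathcal{P}_n$ be the $\langle\cdot,\cdot\rangle_\mu$-orthogonal complement of $\mathcal{P}_{n-1]}$ in $\mathcal{P}_{n]}$, and $P_n:\mathcal{P}\to\mathcal{P}_n$ the orthogonal projection. For $v=(v_1,\dots,v_d)\in\mathbb{C}^d$ let $X_v=\sum_j v_jX_j$ (multiplication operator), $a^+_v=\sum_n P_{n+1}X_vP_n$ on $\mathcal{P}$, and $a^0_{v|n}=P_nX_vP_n|_{\mathcal{P}_n}:\mathcal{P}_n\to\mathcal{P}_n$. $(\mathbb{C}^d)^{\hat\otimes n}$ is the space of symmetric tensors of order $n$, $v_n\hat\otimes\cdots\hat\otimes v_1$ is the symmetrization of $v_n\otimes\cdots\otimes v_1$, and the tensor scalar product satisfies $\langle u^{\otimes n},v^{\otimes n}\rangle=\langle u,v\rangle_{\mathbb{C}^d}^n$ with the standard scalar product on $\mathbb{C}^d$. The linear isomorphism $U_n:(\mathbb{C}^d)^{\hat\otimes n}\to\mathcal{P}_n$ is given by $U_n(v_n\hat\otimes\cdots\hat\otimes v_1)=a^+_{v_n}\cdots a^+_{v_1}1$, $U_0(z)=z\cdot1$. The Jacobi sequences are: $\Omega_n$, the linear operator on $(\mathbb{C}^d)^{\hat\otimes n}$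 with $\langle\xi,\Omega_n\eta\rangle_{(\mathbb{C}^d)^{\hat\otimes n}}=\langle U_n\xi,U_n\eta\rangle_\mu$; and $\alpha_{v|n}=U_n^{-1}a^0_{v|n}U_n$, $v\in\mathbb{C}^d$. Let $(e_1,\dots,e_d)$ be the canonical basis of $\mathbb{C}^d$. Two tuples in $\{1,\dots,d\}^n$ are equivalent if every $l\in\{1,\dots,d\}$ occurs the same number of times in both; $cl(\cdot)$ denotes the equivalence class and $\mathcal{A}_n$ the set of classes. For $\overline{j}_n=cl((j_1,\dots,j_n))$ put $e_{\overline{j}_n}=e_{j_1}\hat\otimes\cdots\hat\otimes e_{j_n}$. The coefficients of $\Omega_n$ in this basis mean $\lambda_{\overline{i}_n,\overline{j}_n}=\langle e_{\overline{i}_n},\Omega_n e_{\overline{j}_n}\rangle_{(\mathbb{C}^d)^{\hat\otimes n}}$. $\delta$ is the Kronecker symbol. *)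

theory Defs
  imports
    "HOL-Analysis.Analysis"
    "HOL-Library.Poly_Mapping"
    "HOL-Library.Function_Algebras"
    "HOL-Combinatorics.Permutations"
begin

text \<open>
  The finite type \<open>'d\<close> is the index set of the variables, so the number of variables
  is \<open>CARD('d)\<close>, which is at least 1.
\<close>

type_synonym 'd cpoly = "('d \<Rightarrow>\<^sub>0 nat) \<Rightarrow>\<^sub>0 complex"

definition scal :: "complex \<Rightarrow> ('d::finite) cpoly \<Rightarrow> 'd cpoly" where
  "scal c p = Poly_Mapping.single 0 c * p"

definition peval :: "('d::finite) cpoly \<Rightarrow> real ^ 'd \<Rightarrow> complex" where
  "peval p x = (\<Sum>m\<in>Poly_Mapping.keys p.
     Poly_Mapping.lookup p m * (\<Prod>i\<in>UNIV. complex_of_real (x $ i) ^ Poly_Mapping.lookup m i))"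

definition mdegree :: "('d::finite \<Rightarrow>\<^sub>0 nat) \<Rightarrow> nat" where
  "mdegree m = (\<Sum>i\<in>UNIV. Poly_Mapping.lookup m i)"

text \<open>The bound is an integer so that \<open>polys_upto (-1)\<close> is \<open>{0}\<close>.\<close>

definition polys_upto :: "int \<Rightarrow> ('d::finite) cpoly set" where
  "polys_upto k = {p. \<forall>m\<in>Poly_Mapping.keys p. int (mdegree m) \<le> k}"

definition X_lin :: "complex ^ 'd \<Rightarrow> ('d::finite) cpoly" where
  "X_lin v = (\<Sum>j\<in>UNIV. scal (v $ j) (Poly_Mapping.single (Poly_Mapping.single j 1) 1))"

definition poly_inner :: "(real ^ 'd) measure \<Rightarrow> ('d::finite) cpoly \<Rightarrow> 'd cpoly \<Rightarrow> complex" where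
  "poly_inner M p q = (\<integral>x. cnj (peval p x) * peval q x \<partial>M)"

definition ortho_polys :: "(real ^ 'd) measure \<Rightarrow> nat \<Rightarrow> ('d::finite) cpoly set" where
  "ortho_polys M n =
     {p \<in> polys_upto (int n). \<forall>q\<in>polys_upto (int n - 1). poly_inner M q p = 0}"

definition ortho_proj :: "(real ^ 'd) measure \<Rightarrow> nat \<Rightarrow> ('d::finite) cpoly \<Rightarrow> 'd cpoly" where
  "ortho_proj M n p =
     (THE q. q \<in> ortho_polys M n \<and> (\<forall>r\<in>ortho_polys M n. poly_inner M r (p - q) = 0))"

text \<open>
  For each polynomial only finitely many summands are nonzero;
  \<^const>\<open>Sum_any\<close> adds up the nonzero ones.
\<close>

definition creation ::
    "(real ^ 'd) measure \<Rightarrow> complex ^ 'd \<Rightarrow> ('d::finite) cpoly \<Rightarrow> 'd cpoly" where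
  "creation M v p = Sum_any (\<lambda>n. ortho_proj M (Suc n) (X_lin v * ortho_proj M n p))"

definition preservation ::
    "(real ^ 'd) measure \<Rightarrow> complex ^ 'd \<Rightarrow> nat \<Rightarrow> ('d::finite) cpoly \<Rightarrow> 'd cpoly" where
  "preservation M v n =
     restrict (\<lambda>p. ortho_proj M n (X_lin v * ortho_proj M n p)) (ortho_polys M n)"

text \<open>
  A tensor of order \<open>n\<close> over \<open>complex ^ 'd\<close> is given by its coordinates with respect to
  the tensor powers of the canonical basis: a function on the index tuples, i.e. the lists of
  length \<open>n\<close> over \<open>'d\<close>, which is set to zero on lists of any other length.
\<close>

type_synonym 'd tensor = "'d list \<Rightarrow> complex"

definition tscal :: "complex \<Rightarrow> 'd tensor \<Rightarrow> 'd tensor" where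
  "tscal c t = (\<lambda>js. c * t js)"

definition sym_tensors :: "nat \<Rightarrow> 'd tensor set" where
  "sym_tensors n =
     {t. (\<forall>js. length js \<noteq> n \<longrightarrow> t js = 0) \<and>
         (\<forall>js \<pi>. length js = n \<and> \<pi> permutes {..<n} \<longrightarrow> t (permute_list \<pi> js) = t js)}"

definition tensor_inner :: "nat \<Rightarrow> ('d::finite) tensor \<Rightarrow> 'd tensor \<Rightarrow> complex" where
  "tensor_inner n s t = (\<Sum>js | length js = n. cnj (s js) * t js)"

definition tensor_prod :: "(complex ^ 'd) list \<Rightarrow> ('d::finite) tensor" where
  "tensor_prod vs =
     (\<lambda>js. if length js = length vs then \<Prod>k<length vs. vs ! k $ (js ! k) else 0)"

definition sym_prod :: "(complex ^ 'd) list \<Rightarrow> ('d::finite) tensor" where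
  "sym_prod vs = (\<lambda>js. (1 / fact (length vs)) *
     (\<Sum>\<pi> | \<pi> permutes {..<length vs}. tensor_prod (permute_list \<pi> vs) js))"

definition linear_map_on ::
    "'a set \<Rightarrow> (complex \<Rightarrow> 'a \<Rightarrow> 'a) \<Rightarrow> (complex \<Rightarrow> 'b \<Rightarrow> 'b) \<Rightarrow> ('a::plus \<Rightarrow> 'b::plus) \<Rightarrow> bool" where
  "linear_map_on V sa sb f \<longleftrightarrow>
     (\<forall>x\<in>V. \<forall>y\<in>V. f (x + y) = f x + f y) \<and> (\<forall>c. \<forall>x\<in>V. f (sa c x) = sb c (f x))"

text \<open>
  Membership in \<^const>\<open>extensional\<close> only fixes the irrelevant values outside the domain, so
  that the descriptions below are unique.
\<close>

definition U_iso :: "(real ^ 'd) measure \<Rightarrow> nat \<Rightarrow> ('d::finite) tensor \<Rightarrow> 'd cpoly" where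
  "U_iso M n = (THE U. U \<in> extensional (sym_tensors n) \<and>
     linear_map_on (sym_tensors n) tscal scal U \<and>
     bij_betw U (sym_tensors n) (ortho_polys M n) \<and>
     (\<forall>vs. length vs = n \<longrightarrow> U (sym_prod vs) = foldr (creation M) vs 1))"

definition jacobi_Omega :: "(real ^ 'd) measure \<Rightarrow> nat \<Rightarrow> ('d::finite) tensor \<Rightarrow> 'd tensor" where
  "jacobi_Omega M n = (THE \<Omega>. \<Omega> \<in> extensional (sym_tensors n) \<and>
     \<Omega> ` sym_tensors n \<subseteq> sym_tensors n \<and>
     linear_map_on (sym_tensors n) tscal tscal \<Omega> \<and>
     (\<forall>\<xi>\<in>sym_tensors n. \<forall>\<eta>\<in>sym_tensors n.
        tensor_inner n \<xi> (\<Omega> \<eta>) = poly_inner M (U_iso M n \<xi>) (U_iso M n \<eta>)))"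

definition jacobi_alpha ::
    "(real ^ 'd) measure \<Rightarrow> complex ^ 'd \<Rightarrow> nat \<Rightarrow> ('d::finite) tensor \<Rightarrow> 'd tensor" where
  "jacobi_alpha M v n = restrict
     (\<lambda>\<xi>. inv_into (sym_tensors n) (U_iso M n) (preservation M v n (U_iso M n \<xi>)))
     (sym_tensors n)"

text \<open>Tuples are lists, so their positions are numbered from 0.\<close>

definition occ :: "'d list \<Rightarrow> 'd \<Rightarrow> nat" where
  "occ js l = card {k. k < length js \<and> js ! k = l}"

definition cl :: "'d list \<Rightarrow> 'd list set" where
  "cl js = {is. length is = length js \<and> (\<forall>l. occ is l = occ js l)}"

text \<open>
  \<open>e_cl C\<close> is the common value of the symmetrized products of canonical basis vectors
  over all tuples in the class \<open>C\<close>.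
\<close>

definition e_cl :: "'d list set \<Rightarrow> ('d::finite) tensor" where
  "e_cl C = the_elem ((\<lambda>js. sym_prod (map (\<lambda>j. axis j 1) js)) ` C)"

definition Omega_coeff ::
    "(real ^ 'd) measure \<Rightarrow> nat \<Rightarrow> ('d::finite) list set \<Rightarrow> 'd list set \<Rightarrow> complex" where
  "Omega_coeff M n I J = tensor_inner n (e_cl I) (jacobi_Omega M n (e_cl J))"

definition hermite_measure :: "(real ^ 'd::finite) measure" where
  "hermite_measure = density lborel (\<lambda>x. ennreal (exp (- (\<Sum>i\<in>UNIV. (x $ i)\<^sup>2))))"

end

theory Submission
  imports Defs "HOL-Probability.Distributions"
begin

text \<open>
  The weight is a product over the coordinates, so the products \<open>hermite m\<close> of monic one-variable
  Hermite polynomials, one for each multi-index \<open>m\<close>, are pairwise orthogonal, and the squared norm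
  of \<open>hermite m\<close> is the product over \<open>l\<close> of \<open>sqrt pi * fact m\<^sub>l / 2 ^ m\<^sub>l\<close> (\<open>hinner_hermite\<close>).
  They form a triangular basis of the polynomials with respect to the degree, so the ones of degree \<open>n\<close> are a basis of the \<open>n\<close>-th
  orthogonal space, and the projection onto it reads off Hermite coefficients
  (\<open>ortho_proj_eq_hproj\<close>).

  Everything else comes from the three-term recurrence
  \<open>X\<^sub>j hermite m = hermite (m + e\<^sub>j) + (m\<^sub>j / 2) hermite (m - e\<^sub>j)\<close> (\<open>xvar_mult_hermite\<close>). It has no term of
  degree \<open>|m|\<close>, reflecting that the weight is even; hence the preservation operators vanish, and so
  does \<open>\<alpha>\<close>.
  Its term of degree \<open>|m| + 1\<close> shows that creation with \<open>e\<^sub>j\<close> maps \<open>hermite m\<close> to \<open>hermite (m + e\<^sub>j)\<close>.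
  Therefore \<open>U\<^sub>n\<close> sends the symmetrized basis tensor of a tuple \<open>js\<close> to \<open>hermite (midx js)\<close>, where
  \<open>midx js\<close> counts how often each index occurs (\<open>U_iso_hermite\<close>, \<open>hermite_map_sym_basis\<close>). The
  coefficients of \<open>\<Omega>\<^sub>n\<close> are then the Gram matrix of the Hermite polynomials, which is diagonal with
  the entries above, because two tuples are in the same class exactly if they have the same
  multi-index.

  As \<open>U_iso\<close>, \<open>jacobi_Omega\<close> and \<open>ortho_proj\<close> are definite descriptions, each of them is computed by
  exhibiting an explicit operator with the describing property and proving uniqueness. Uniqueness
  on symmetric tensors rests on \<open>sym_tensor_expansion\<close> (the symmetrized basis tensors span) and
  \<open>tensor_inner_sym_basis\<close> (pairing with them recovers the coordinates).
\<close>

section \<open>One-dimensional Hermite polynomials\<close>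

definition gauss_int :: "real poly \<Rightarrow> real" where
  "gauss_int p = (\<integral>x. exp (- x\<^sup>2) * poly p x \<partial>lborel)"

lemma gauss_moment_even:
  "has_bochner_integral lborel (\<lambda>x::real. exp (- x\<^sup>2) * x ^ (2 * k))
     (sqrt pi * (fact (2 * k) / (2 ^ (2 * k) * fact k)))"
  using has_bochner_integral_even_function[OF gaussian_moment_even_pos[where k=k]] by simp

lemma gauss_moment_odd:
  "has_bochner_integral lborel (\<lambda>x::real. exp (- x\<^sup>2) * x ^ (2 * k + 1)) 0"
  by (rule has_bochner_integral_odd_function[OF gaussian_moment_odd_pos]) simp

lemma integrable_gauss_poly:
  "integrable lborel (\<lambda>x::real. exp (- x\<^sup>2) * poly p x)"
proof -
  have "integrable lborel (\<lambda>x::real. exp (- x\<^sup>2) * x ^ k)" for k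
    using gauss_moment_even[of "k div 2"] gauss_moment_odd[of "k div 2"]
    by (cases "even k") (auto simp: has_bochner_integral_iff elim!: evenE oddE)
  then have "integrable lborel (\<lambda>x::real. \<Sum>i\<le>degree p. coeff p i * (exp (- x\<^sup>2) * x ^ i))"
    by (intro Bochner_Integration.integrable_sum integrable_mult_right) auto
  then show ?thesis
    by (simp add: poly_altdef sum_distrib_left mult_ac)
qed

lemma gauss_int_add: "gauss_int (p + q) = gauss_int p + gauss_int q"
  by (simp add: gauss_int_def distrib_left Bochner_Integration.integral_add integrable_gauss_poly)

lemma gauss_int_smult: "gauss_int (smult c p) = c * gauss_int p"
proof -
  have "gauss_int (smult c p) = (\<integral>x. c * (exp (- x\<^sup>2) * poly p x) \<partial>lborel)"
    unfolding gauss_int_def by (simp add: mult_ac)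
  then show ?thesis by (simp add: gauss_int_def)
qed

lemma gauss_int_0 [simp]: "gauss_int 0 = 0"
  by (simp add: gauss_int_def)

lemma gauss_int_diff: "gauss_int (p - q) = gauss_int p - gauss_int q"
  using gauss_int_add[of p "smult (-1) q"] gauss_int_smult[of "-1" q] by simp

lemma gauss_int_monom:
  "gauss_int (monom c k) =
     (if even k then c * (sqrt pi * (fact k / (2 ^ k * fact (k div 2)))) else 0)"
proof -
  have "gauss_int (monom 1 k) =
     (if even k then sqrt pi * (fact k / (2 ^ k * fact (k div 2))) else 0)"
    using gauss_moment_even[of "k div 2"] gauss_moment_odd[of "k div 2"]
    by (auto simp: gauss_int_def poly_monom has_bochner_integral_iff elim!: evenE oddE)
  then show ?thesis
    using gauss_int_smult[of c "monom 1 k"] by (simp add: smult_monom)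
qed

text \<open>
  Integration by parts against the weight \<open>exp (- x\<^sup>2)\<close>, whose derivative is \<open>-2x\<close> times itself. By
  linearity it suffices to compare the known moments of monomials.
\<close>

lemma gauss_int_by_parts: "gauss_int (pderiv p) = 2 * gauss_int ([:0, 1:] * p)"
proof -
  have m: "gauss_int (pderiv (monom c k)) = 2 * gauss_int ([:0, 1:] * monom c k)" for c k
  proof -
    have x: "[:0, 1:] * monom c k = monom c (Suc k)"
      by (simp add: monom_Suc)
    show ?thesis
    proof (cases "odd k")
      case True
      then obtain j where "k = 2 * j + 1" by (elim oddE)
      moreover have "fact (2 * j + 2) / (2 ^ (2 * j + 2) * fact (j + 1))
          = (2 * real j + 1) / 2 * (fact (2 * j) / (2 ^ (2 * j) * fact j))"
      proof -
        have "(fact (2 * j + 2) :: real) = 2 * (real j + 1) * ((2 * real j + 1) * fact (2 * j))"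
          and "(fact (j + 1) :: real) = (real j + 1) * fact j"
          by (simp_all add: algebra_simps)
        moreover have "real j + 1 \<noteq> 0" by linarith
        ultimately show ?thesis by (simp add: divide_simps) (simp add: algebra_simps)
      qed
      ultimately show ?thesis
        unfolding x pderiv_monom gauss_int_monom
        by (simp add: algebra_simps) (simp add: field_simps)
    next
      case False
      then show ?thesis
        unfolding x pderiv_monom gauss_int_monom by (cases k) auto
    qed
  qed
  have "gauss_int (pderiv (\<Sum>i\<le>n. monom (coeff p i) i))
      = 2 * gauss_int ([:0, 1:] * (\<Sum>i\<le>n. monom (coeff p i) i))" for n
    by (induction n) (simp_all only: sum.atMost_Suc atMost_0 sum.insert finite.emptyI
        sum.empty empty_iff not_False_eq_True add_0_right pderiv_add gauss_int_add distrib_left m)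
  from this[of "degree p"] show ?thesis
    by (simp only: poly_as_sum_of_monoms)
qed

text \<open>
  The physicists' Hermite polynomials divided by \<open>2\<^sup>k\<close>, so that they are monic.
\<close>

fun herm :: "nat \<Rightarrow> real poly" where
  "herm 0 = 1"
| "herm (Suc 0) = [:0, 1:]"
| "herm (Suc (Suc k)) = [:0, 1:] * herm (Suc k) - smult ((real k + 1) / 2) (herm k)"

lemma pderiv_herm: "pderiv (herm (Suc k)) = smult (real k + 1) (herm k)"
proof (induction k rule: herm.induct)
  case (3 k)
  have *: "pderiv [:0, 1::real:] = 1" by (simp add: pderiv_pCons)
  have "pderiv (herm (Suc (Suc (Suc k)))) =
     [:0, 1:] * smult (real k + 2) (herm (Suc k)) + herm (Suc (Suc k))
      - smult ((real k + 2) / 2) (smult (real k + 1) (herm k))"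
    by (simp only: herm.simps(3)[of "Suc k"] pderiv_diff pderiv_mult * 3 pderiv_smult) (simp add: add_ac)
  also have "\<dots> = smult (real k + 2) ([:0, 1:] * herm (Suc k) - smult ((real k + 1) / 2) (herm k))
      + herm (Suc (Suc k))"
    by (simp add: smult_diff_right mult_ac)
  also have "\<dots> = smult (real k + 2) (herm (Suc (Suc k))) + herm (Suc (Suc k))"
    by (simp only: herm.simps(3))
  also have "\<dots> = smult (real (Suc (Suc k)) + 1) (herm (Suc (Suc k)))"
    using smult_add_left[of "real k + 2" 1 "herm (Suc (Suc k))"]
    by (simp add: add_ac del: herm.simps)
  finally show ?case .
qed (simp_all add: pderiv_pCons)

text \<open>
  The raising operator \<open>x - (1/2) d/dx\<close>: this is the adjoint of \<open>(1/2) d/dx\<close> for the Gaussian weight,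
  which makes \<open>gauss_int_herm_step\<close> an instance of integration by parts.
\<close>

lemma herm_Suc: "herm (Suc k) = [:0, 1:] * herm k - smult (1 / 2) (pderiv (herm k))"
  by (cases k) (simp_all add: pderiv_herm pderiv_1 del: mult_pCons_left)

lemma gauss_int_herm_step:
  "gauss_int (herm (Suc k) * q) = gauss_int (herm k * pderiv q) / 2"
proof -
  have "gauss_int (herm (Suc k) * q) =
     gauss_int ([:0, 1:] * (herm k * q)) - gauss_int (pderiv (herm k) * q) / 2"
    by (simp only: herm_Suc left_diff_distrib gauss_int_diff mult_smult_left gauss_int_smult mult.assoc)
  also have "gauss_int ([:0, 1:] * (herm k * q)) = gauss_int (pderiv (herm k * q)) / 2"
    using gauss_int_by_parts by simp
  also have "gauss_int (pderiv (herm k * q)) =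
      gauss_int (herm k * pderiv q) + gauss_int (pderiv (herm k) * q)"
    by (simp add: pderiv_mult gauss_int_add mult.commute)
  finally show ?thesis by (simp add: field_simps)
qed

text \<open>
  Each use of \<open>gauss_int_herm_step\<close> trades \<open>h\<^sub>k h\<^sub>l\<close> for \<open>(l / 2) h\<^bsub>k-1\<^esub> h\<^bsub>l-1\<^esub>\<close>. If the degrees differ, this
  ends at the derivative of a constant; otherwise the factors \<open>l / 2\<close> multiply up to \<open>k! / 2\<^sup>k\<close>.
\<close>

lemma gauss_int_herm_herm:
  "gauss_int (herm k * herm l) = (if k = l then sqrt pi * fact k / 2 ^ k else 0)"
proof (induction k arbitrary: l)
  case 0
  show ?case
  proof (cases l)
    case 0
    then show ?thesis using gauss_int_monom[of 1 0] by simp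
  next
    case (Suc l')
    then have "gauss_int (herm 0 * herm l) = gauss_int (herm l' * pderiv 1) / 2"
      using gauss_int_herm_step[of l' 1] by simp
    then show ?thesis using Suc by (simp add: pderiv_1)
  qed
next
  case (Suc k)
  show ?case
  proof (cases l)
    case 0
    then show ?thesis
      using gauss_int_herm_step[of k 1] by (simp add: pderiv_1)
  next
    case (Suc l')
    have "gauss_int (herm (Suc k) * herm l) = (real l' + 1) * gauss_int (herm k * herm l') / 2"
      by (simp only: gauss_int_herm_step Suc pderiv_herm mult_smult_right gauss_int_smult)
    also have "\<dots> = (if Suc k = l then sqrt pi * fact (Suc k) / 2 ^ Suc k else 0)"
      by (simp add: Suc.IH Suc field_simps)
    finally show ?thesis .
  qed
qed

text \<open>
  Fubini: Lebesgue measure on \<open>real ^ 'd\<close> is the image of the product measure indexed by the standard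
  basis, and the weight is a product over the coordinates. As the factors here are indexed by \<open>'d\<close>
  and not by basis vectors, the proof translates through \<open>i \<mapsto> axis i 1\<close>.
\<close>

lemma
  fixes p :: "'d::finite \<Rightarrow> real poly"
  shows integrable_hermite_prod:
      "integrable hermite_measure (\<lambda>x::real^'d. complex_of_real (\<Prod>i\<in>UNIV. poly (p i) (x $ i)))"
    and integral_hermite_prod:
      "(\<integral>x. complex_of_real (\<Prod>i\<in>UNIV. poly (p i) (x $ i)) \<partial>(hermite_measure :: (real^'d) measure))
        = complex_of_real (\<Prod>i\<in>UNIV. gauss_int (p i))"
proof -
  let ?e = "\<lambda>i. axis i (1::real) :: real ^ 'd"
  let ?idx = "\<lambda>b. (THE i. b = ?e i) :: 'd"
  let ?f = "\<lambda>b t. exp (- t\<^sup>2) * poly (p (?idx b)) t"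
  let ?T = "\<lambda>f. \<Sum>b\<in>Basis. f b *\<^sub>R b :: real ^ 'd"
  let ?g = "\<lambda>x::real^'d. \<Prod>i\<in>UNIV. exp (- (x $ i)\<^sup>2) * poly (p i) (x $ i)"
  have idx [simp]: "?idx (?e i) = i" for i
    by (rule the_equality) (auto simp: axis_eq_axis)
  have inje: "inj_on ?e UNIV" by (auto simp: inj_on_def axis_eq_axis)
  have Bas: "(Basis :: (real^'d) set) = range ?e"
    by (auto simp: Basis_vec_def)
  have prodB: "(\<Prod>b\<in>(Basis :: (real^'d) set). h b) = (\<Prod>i\<in>UNIV. h (?e i))" for h :: "_ \<Rightarrow> real"
    unfolding Bas by (subst prod.reindex[OF inje]) simp
  have comp: "?T f $ i = f (?e i)" for f i
    using inner_sum_left_Basis[of "?e i" f] by (simp add: inner_axis)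
  interpret product_sigma_finite "\<lambda>_::real^'d. lborel :: real measure" ..
  have gT: "?g (?T f) = (\<Prod>b\<in>Basis. ?f b (f b))" for f
    by (simp only: comp prodB idx)
  have meas [measurable]: "?g \<in> borel_measurable borel" 
    by (intro borel_measurable_continuous_onI continuous_intros)
  have T [measurable]: "?T \<in> measurable (\<Pi>\<^sub>M b\<in>Basis. lborel) borel"
    by measurable
  have int_g: "integrable lborel ?g"
    by (subst lborel_eq, subst integrable_distr_eq[OF T], simp, unfold gT)
      (intro product_integrable_prod finite_Basis integrable_gauss_poly)
  have "integral\<^sup>L lborel ?g = (\<Prod>b\<in>(Basis :: (real^'d) set). \<integral>t. ?f b t \<partial>lborel)"
    by (subst lborel_eq, subst integral_distr[OF T], simp, unfold gT)
      (intro product_integral_prod finite_Basis integrable_gauss_poly)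
  then have val_g: "integral\<^sup>L lborel ?g = (\<Prod>i\<in>UNIV. gauss_int (p i))"
    by (simp add: prodB gauss_int_def)
  have weight: "exp (- (\<Sum>i\<in>UNIV. (x $ i)\<^sup>2)) *\<^sub>R complex_of_real (\<Prod>i\<in>UNIV. poly (p i) (x $ i))
      = complex_of_real (?g x)" for x :: "real^'d"
    by (simp add: prod.distrib exp_sum scaleR_conv_of_real sum_negf[symmetric])
  have c [measurable]: "(\<lambda>x::real^'d. complex_of_real (\<Prod>i\<in>UNIV. poly (p i) (x $ i))) \<in> borel_measurable borel"
    "(\<lambda>x::real^'d. exp (- (\<Sum>i\<in>UNIV. (x $ i)\<^sup>2))) \<in> borel_measurable borel"
    by (intro borel_measurable_continuous_onI continuous_intros)+
  show "integrable hermite_measure (\<lambda>x::real^'d. complex_of_real (\<Prod>i\<in>UNIV. poly (p i) (x $ i)))"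
    unfolding hermite_measure_def
    by (subst integrable_density) (simp_all only: weight integrable_of_real int_g c measurable_lborel2, simp_all)
  show "(\<integral>x. complex_of_real (\<Prod>i\<in>UNIV. poly (p i) (x $ i)) \<partial>(hermite_measure :: (real^'d) measure))
        = complex_of_real (\<Prod>i\<in>UNIV. gauss_int (p i))"
    unfolding hermite_measure_def
    by (subst integral_density) (simp_all only: weight integral_complex_of_real val_g c measurable_lborel2, simp_all)
qed

section \<open>Evaluation and degree of polynomials in several variables\<close>

abbreviation xvar :: "'d::finite \<Rightarrow> 'd cpoly" where
  "xvar j \<equiv> Poly_Mapping.single (Poly_Mapping.single j 1) 1"

lemma scal_add_right: "scal c (p + q) = scal c p + scal c q"
  by (simp add: scal_def distrib_left)

lemma scal_scal: "scal c (scal d p) = scal (c * d) p"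
  by (simp add: scal_def mult.assoc[symmetric] mult_single)

lemma scal_1 [simp]: "scal 1 p = p"
  by (simp add: scal_def)

lemma scal_0 [simp]: "scal 0 p = 0"
  by (simp add: scal_def)

lemma scal_zero_right [simp]: "scal c 0 = 0"
  by (simp add: scal_def)

lemma scal_add_left: "scal (c + d) p = scal c p + scal d p"
  by (simp add: scal_def single_add distrib_right)

lemma scal_sum_right: "scal c (sum f A) = (\<Sum>a\<in>A. scal c (f a))"
  by (simp add: scal_def sum_distrib_left)

lemma scal_sum_left: "scal (sum f A) p = (\<Sum>a\<in>A. scal (f a) p)"
  by (induction A rule: infinite_finite_induct) (simp_all add: scal_add_left)

lemma scal_mult_left: "scal c p * q = scal c (p * q)"
  by (simp add: scal_def mult.assoc)

lemma scal_mult_right: "p * scal c q = scal c (p * q)"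
  by (simp add: scal_def mult_ac)

lemma scal_single: "scal c (Poly_Mapping.single m d) = Poly_Mapping.single m (c * d)"
  by (simp add: scal_def mult_single)

lemma cpoly_as_sum:
  "(p :: 'd::finite cpoly)
    = (\<Sum>m\<in>Poly_Mapping.keys p. Poly_Mapping.single m (Poly_Mapping.lookup p m))"
  by (rule poly_mapping_eqI)
    (auto simp: lookup_sum lookup_single when_def in_keys_iff intro: sum.neutral)

lemma cpoly_induct [case_names zero single add]:
  fixes p :: "'d::finite cpoly"
  assumes "P 0" and "\<And>m c. P (Poly_Mapping.single m c)" and "\<And>p q. P p \<Longrightarrow> P q \<Longrightarrow> P (p + q)"
  shows "P p"
proof -
  have "P (\<Sum>m\<in>A. Poly_Mapping.single m (Poly_Mapping.lookup p m))" for A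
    by (induction A rule: infinite_finite_induct) (auto intro: assms)
  then show ?thesis using cpoly_as_sum[of p] by metis
qed

lemma peval_superset:
  assumes "finite S" "Poly_Mapping.keys p \<subseteq> S"
  shows "peval p x = (\<Sum>m\<in>S. Poly_Mapping.lookup p m *
           (\<Prod>i\<in>UNIV. complex_of_real (x $ i) ^ Poly_Mapping.lookup m i))"
  unfolding peval_def using assms
  by (intro sum.mono_neutral_left) (auto simp: in_keys_iff)

lemma peval_add: "peval (p + q) x = peval p x + peval q x"
proof -
  let ?S = "Poly_Mapping.keys p \<union> Poly_Mapping.keys q"
  show ?thesis
    using peval_superset[of ?S p x] peval_superset[of ?S q x] peval_superset[of ?S "p + q" x]
    by (simp add: keys_add lookup_add sum.distrib distrib_right)
qed

lemma peval_0 [simp]: "peval 0 x = 0"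
  by (simp add: peval_def)

lemma peval_single: "peval (Poly_Mapping.single m c) x
    = c * (\<Prod>i\<in>UNIV. complex_of_real (x $ i) ^ Poly_Mapping.lookup m i)"
  by (simp add: peval_superset[of "{m}"])

lemma peval_mult: "peval (p * q) x = peval p x * peval q x"
proof (induction p rule: cpoly_induct)
  case (single m c)
  show ?case
  proof (induction q rule: cpoly_induct)
    case (single l d)
    then show ?case
      by (simp add: mult_single peval_single lookup_add power_add prod.distrib)
  qed (simp_all add: peval_add algebra_simps)
qed (simp_all add: peval_add algebra_simps)

lemma peval_1 [simp]: "peval 1 x = 1"
  using peval_single[of 0 1 x] by simp

lemma peval_prod: "peval (prod f A) x = (\<Prod>a\<in>A. peval (f a) x)"
  by (induction A rule: infinite_finite_induct) (simp_all add: peval_mult)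

lemma peval_scal: "peval (scal c p) x = c * peval p x"
  by (simp add: scal_def peval_mult peval_single)

lemma peval_diff: "peval (p - q) x = peval p x - peval q x"
  using peval_add[of "p - q" q x] by simp

lemma peval_xvar: "peval (xvar j) x = complex_of_real (x $ j)"
proof -
  have "(\<Prod>i\<in>UNIV. complex_of_real (x $ i) ^ Poly_Mapping.lookup (Poly_Mapping.single j 1) i)
      = (\<Prod>i\<in>UNIV. if i = j then complex_of_real (x $ i) else 1)"
    by (intro prod.cong refl) (simp add: lookup_single when_def)
  then show ?thesis by (simp add: peval_single)
qed

lemma polys_upto_0 [simp]: "0 \<in> polys_upto k"
  by (simp add: polys_upto_def)

lemma polys_upto_mono: "p \<in> polys_upto k \<Longrightarrow> k \<le> l \<Longrightarrow> p \<in> polys_upto l"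
  by (force simp: polys_upto_def)

lemma polys_upto_add: "p \<in> polys_upto k \<Longrightarrow> q \<in> polys_upto k \<Longrightarrow> p + q \<in> polys_upto k"
  using keys_add[of p q] by (auto simp: polys_upto_def)

lemma polys_upto_mult:
  "p \<in> polys_upto k \<Longrightarrow> q \<in> polys_upto l \<Longrightarrow> p * q \<in> polys_upto (k + l)"
  using keys_mult[of p q]
  by (fastforce simp: polys_upto_def mdegree_def lookup_add sum.distrib)

lemma one_in_polys_upto: "1 \<in> polys_upto 0"
  by (simp add: polys_upto_def mdegree_def)

lemma polys_upto_scal: "p \<in> polys_upto k \<Longrightarrow> scal c p \<in> polys_upto k"
  using polys_upto_mult[of "Poly_Mapping.single 0 c" 0 p k]
  by (auto simp: scal_def polys_upto_def mdegree_def)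

lemma polys_upto_diff: "p \<in> polys_upto k \<Longrightarrow> q \<in> polys_upto k \<Longrightarrow> p - q \<in> polys_upto k"
  using polys_upto_add[of p k "scal (-1) q"] polys_upto_scal[of q k "-1"]
  by (simp add: scal_def single_uminus)

lemma polys_upto_prod:
  "finite A \<Longrightarrow> (\<And>a. a \<in> A \<Longrightarrow> f a \<in> polys_upto (k a)) \<Longrightarrow> prod f A \<in> polys_upto (sum k A)"
  by (induction A rule: finite_induct) (auto intro: polys_upto_mult one_in_polys_upto)

lemma mdegree_single [simp]: "mdegree (Poly_Mapping.single j k) = k"
proof -
  have "mdegree (Poly_Mapping.single j k) = (\<Sum>i\<in>UNIV. if i = j then k else 0)"
    unfolding mdegree_def by (intro sum.cong refl) (simp add: lookup_single when_def)
  then show ?thesis by simp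
qed

lemma mdegree_add [simp]: "mdegree (m + l) = mdegree m + mdegree l"
  by (simp add: mdegree_def lookup_add sum.distrib)

lemma mdegree_0 [simp]: "mdegree 0 = 0"
  by (simp add: mdegree_def)

lemma xvar_in_polys_upto: "xvar j \<in> polys_upto 1"
  by (simp add: polys_upto_def)

section \<open>The scalar product of the Gaussian measure\<close>

abbreviation hinner :: "('d::finite) cpoly \<Rightarrow> 'd cpoly \<Rightarrow> complex" where
  "hinner \<equiv> poly_inner hermite_measure"

lemma integrable_hinner:
  fixes p q :: "'d::finite cpoly"
  shows "integrable hermite_measure (\<lambda>x. cnj (peval p x) * peval q x)"
proof (induction p rule: cpoly_induct)
  case (single m c)
  show ?case
  proof (induction q rule: cpoly_induct)
    case (single l d)
    have "cnj (peval (Poly_Mapping.single m c) x) * peval (Poly_Mapping.single l d) x =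
      (cnj c * d) * complex_of_real
        (\<Prod>i\<in>UNIV. poly (monom 1 (Poly_Mapping.lookup m i + Poly_Mapping.lookup l i)) (x $ i))" for x
      by (simp add: peval_single poly_monom power_add prod.distrib)
    then show ?case
      by (simp only:) (intro integrable_mult_right integrable_hermite_prod)
  qed (simp_all add: peval_add distrib_left)
qed (simp_all add: peval_add distrib_right)

lemma hinner_add_right: "hinner p (q + r) = hinner p q + hinner p r"
  by (simp add: poly_inner_def peval_add distrib_left integrable_hinner)

lemma hinner_scal_right: "hinner p (scal c q) = c * hinner p q"
proof -
  have "hinner p (scal c q) = (\<integral>x. c * (cnj (peval p x) * peval q x) \<partial>hermite_measure)"
    by (simp add: poly_inner_def peval_scal mult_ac)
  then show ?thesis by (simp add: poly_inner_def)
qed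

lemma cnj_hinner: "cnj (hinner p q) = hinner q p"
proof -
  have "hinner q p = (\<integral>x. cnj (cnj (peval p x) * peval q x) \<partial>hermite_measure)"
    by (simp add: poly_inner_def mult.commute)
  also have "\<dots> = cnj (hinner p q)"
    unfolding poly_inner_def by (rule Bochner_Integration.integral_cnj)
  finally show ?thesis ..
qed

lemma hinner_0_right [simp]: "hinner p 0 = 0"
  by (simp add: poly_inner_def)

lemma hinner_0_left [simp]: "hinner 0 p = 0"
  by (simp add: poly_inner_def)

lemma hinner_add_left: "hinner (p + q) r = hinner p r + hinner q r"
  by (metis cnj_hinner complex_cnj_add hinner_add_right)

lemma hinner_scal_left: "hinner (scal c p) q = cnj c * hinner p q"
  by (metis cnj_hinner complex_cnj_mult hinner_scal_right)

lemma hinner_sum_right: "hinner p (sum f A) = (\<Sum>a\<in>A. hinner p (f a))"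
  by (induction A rule: infinite_finite_induct) (simp_all add: hinner_add_right)

lemma hinner_sum_left: "hinner (sum f A) p = (\<Sum>a\<in>A. hinner (f a) p)"
  by (induction A rule: infinite_finite_induct) (simp_all add: hinner_add_left)

lemma hinner_diff_right: "hinner p (q - r) = hinner p q - hinner p r"
  using hinner_add_right[of p "q - r" r] by simp

section \<open>Hermite polynomials in several variables\<close>

text \<open>
  The recurrence of \<open>herm\<close>, read in the single variable \<open>j\<close>.
\<close>

fun hvar :: "'d::finite \<Rightarrow> nat \<Rightarrow> 'd cpoly" where
  "hvar j 0 = 1"
| "hvar j (Suc 0) = xvar j"
| "hvar j (Suc (Suc k)) = xvar j * hvar j (Suc k) - scal ((of_nat k + 1) / 2) (hvar j k)"

lemma peval_hvar: "peval (hvar j k) x = complex_of_real (poly (herm k) (x $ j))"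
  by (induction k rule: herm.induct)
    (simp_all add: peval_diff peval_mult peval_xvar[simplified] peval_scal)

lemma xvar_mult_hvar:
  "xvar j * hvar j k = hvar j (Suc k) + scal (of_nat k / 2) (hvar j (k - 1))"
  by (cases k) (simp_all add: add.commute)

lemma hvar_in_polys_upto: "hvar j k \<in> polys_upto (int k)"
proof (induction j k rule: hvar.induct)
  case (1 j)
  then show ?case by (simp add: one_in_polys_upto)
next
  case (2 j)
  then show ?case using xvar_in_polys_upto by simp
next
  case (3 j k)
  have "xvar j * hvar j (Suc k) \<in> polys_upto (1 + int (Suc k))"
    by (intro polys_upto_mult xvar_in_polys_upto 3)
  moreover have "scal ((of_nat k + 1) / 2) (hvar j k) \<in> polys_upto (1 + int (Suc k))"
    by (rule polys_upto_mono[OF polys_upto_scal[OF 3(2)]]) simp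
  ultimately show ?case
    unfolding hvar.simps by (intro polys_upto_diff) (simp_all add: add_ac)
qed

definition hermite :: "('d::finite \<Rightarrow>\<^sub>0 nat) \<Rightarrow> 'd cpoly" where
  "hermite m = (\<Prod>j\<in>UNIV. hvar j (Poly_Mapping.lookup m j))"

definition hsqnorm :: "('d::finite \<Rightarrow>\<^sub>0 nat) \<Rightarrow> complex" where
  "hsqnorm m = complex_of_real
     (\<Prod>j\<in>UNIV. sqrt pi * fact (Poly_Mapping.lookup m j) / 2 ^ Poly_Mapping.lookup m j)"

lemma hsqnorm_nonzero [simp]: "hsqnorm m \<noteq> 0"
  by (simp add: hsqnorm_def)

text \<open>
  The integrand factors over the coordinates, and one vanishing one-dimensional factor is enough for
  orthogonality.
\<close>

lemma hinner_hermite: "hinner (hermite m) (hermite l) = (if m = l then hsqnorm m else 0)"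
proof -
  have "hinner (hermite m) (hermite l) = (\<integral>x. complex_of_real
     (\<Prod>j\<in>UNIV. poly (herm (Poly_Mapping.lookup m j) * herm (Poly_Mapping.lookup l j)) (x $ j))
       \<partial>hermite_measure)"
    by (simp add: poly_inner_def hermite_def peval_prod peval_hvar prod.distrib)
  also have "\<dots> = complex_of_real
     (\<Prod>j\<in>UNIV. gauss_int (herm (Poly_Mapping.lookup m j) * herm (Poly_Mapping.lookup l j)))"
    by (rule integral_hermite_prod)
  also have "\<dots> = (if m = l then hsqnorm m else 0)"
  proof (cases "m = l")
    case False
    then obtain j where "Poly_Mapping.lookup m j \<noteq> Poly_Mapping.lookup l j"
      by (meson poly_mapping_eqI)
    then have "\<exists>j. gauss_int (herm (Poly_Mapping.lookup m j) * herm (Poly_Mapping.lookup l j)) = 0"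
      by (auto simp: gauss_int_herm_herm)
    with False show ?thesis by auto
  qed (simp add: hsqnorm_def gauss_int_herm_herm)
  finally show ?thesis .
qed

lemma hermite_in_polys_upto: "hermite m \<in> polys_upto (int (mdegree m))"
  unfolding hermite_def mdegree_def of_nat_sum
  by (intro polys_upto_prod hvar_in_polys_upto) simp

lemma hermite_0 [simp]: "hermite 0 = 1"
  by (simp add: hermite_def)

text \<open>
  Only the factor of the variable \<open>j\<close> changes. For \<open>m\<^sub>j = 0\<close> the truncated subtraction makes
  \<open>m - e\<^sub>j = m\<close>, which is harmless because the coefficient is then zero.
\<close>

lemma xvar_mult_hermite:
  "xvar j * hermite m = hermite (m + Poly_Mapping.single j 1)
     + scal (of_nat (Poly_Mapping.lookup m j) / 2) (hermite (m - Poly_Mapping.single j 1))"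
proof -
  let ?R = "\<Prod>i\<in>UNIV - {j}. hvar i (Poly_Mapping.lookup m i)"
  have split: "hermite l = hvar j (Poly_Mapping.lookup l j) * ?R"
    if "\<And>i. i \<noteq> j \<Longrightarrow> Poly_Mapping.lookup l i = Poly_Mapping.lookup m i" for l
    unfolding hermite_def using that by (subst prod.remove[of _ j]) auto
  have "xvar j * hermite m = (xvar j * hvar j (Poly_Mapping.lookup m j)) * ?R"
    by (simp only: split[of m] mult.assoc)
  also have "\<dots> = hvar j (Suc (Poly_Mapping.lookup m j)) * ?R
     + scal (of_nat (Poly_Mapping.lookup m j) / 2) (hvar j (Poly_Mapping.lookup m j - 1) * ?R)"
    by (simp only: xvar_mult_hvar distrib_right scal_mult_left)
  also have "hvar j (Suc (Poly_Mapping.lookup m j)) * ?R = hermite (m + Poly_Mapping.single j 1)"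
    by (subst split) (simp_all add: lookup_add lookup_single when_def)
  also have "hvar j (Poly_Mapping.lookup m j - 1) * ?R = hermite (m - Poly_Mapping.single j 1)"
    by (subst split) (simp_all add: lookup_minus lookup_single when_def)
  finally show ?thesis .
qed

section \<open>Multi-indices and index tuples\<close>

lemma multiindex_minus_add:
  assumes "Poly_Mapping.lookup m j \<noteq> 0"
  shows "m = (m - Poly_Mapping.single j (1::nat)) + Poly_Mapping.single j 1"
proof (rule poly_mapping_eqI)
  fix k
  show "Poly_Mapping.lookup m k
      = Poly_Mapping.lookup ((m - Poly_Mapping.single j 1) + Poly_Mapping.single j 1) k"
    using assms by (cases "k = j") (simp_all add: lookup_add lookup_minus lookup_single when_def)
qed

lemma multiindex_induct [case_names zero step]:
  fixes m :: "'d::finite \<Rightarrow>\<^sub>0 nat"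
  assumes "P 0" and step: "\<And>l j. P l \<Longrightarrow> P (l + Poly_Mapping.single j 1)"
  shows "P m"
proof (induction "mdegree m" arbitrary: m)
  case 0
  then have "m = 0" by (intro poly_mapping_eqI) (simp add: mdegree_def)
  with assms(1) show ?case by simp
next
  case (Suc n)
  then obtain j where "Poly_Mapping.lookup m j \<noteq> 0"
    unfolding mdegree_def by (metis sum.neutral nat.distinct(1))
  then have m: "m = (m - Poly_Mapping.single j 1) + Poly_Mapping.single j 1"
    by (rule multiindex_minus_add)
  then have "mdegree m = mdegree (m - Poly_Mapping.single j 1) + 1"
    by (metis mdegree_add mdegree_single)
  with Suc have "P (m - Poly_Mapping.single j 1)" by simp
  then show ?case using step m by metis
qed

primrec midx :: "'d list \<Rightarrow> 'd \<Rightarrow>\<^sub>0 nat" where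
  "midx [] = 0"
| "midx (j # js) = midx js + Poly_Mapping.single j 1"

lemma lookup_midx: "Poly_Mapping.lookup (midx js) l = count (mset js) l"
  by (induction js) (simp_all add: lookup_add lookup_single when_def)

lemma midx_eq_iff: "midx is = midx js \<longleftrightarrow> mset is = mset js"
  by (metis lookup_midx multiset_eqI poly_mapping_eqI)

lemma mdegree_midx [simp]: "mdegree (midx js) = length js"
  by (induction js) simp_all

lemma midx_surj: "\<exists>js. midx js = (m :: 'd::finite \<Rightarrow>\<^sub>0 nat)"
proof (induction m rule: multiindex_induct)
  case zero
  show ?case by (rule exI[of _ "[]"]) simp
next
  case (step l j)
  then obtain js where "midx js = l" ..
  then show ?case by (intro exI[of _ "j # js"]) simp
qed

lemma midx_permute_list:
  "\<pi> permutes {..<length js} \<Longrightarrow> midx (permute_list \<pi> js) = midx js"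
  by (simp add: midx_eq_iff)

abbreviation tuples :: "nat \<Rightarrow> 'd list set" where
  "tuples n \<equiv> {js. length js = n}"

abbreviation degs :: "nat \<Rightarrow> ('d::finite \<Rightarrow>\<^sub>0 nat) set" where
  "degs n \<equiv> {m. mdegree m = n}"

lemma finite_tuples [simp]: "finite (tuples n :: 'd::finite list set)"
  using finite_lists_length_eq[of "UNIV :: 'd set" n] by simp

lemma finite_degs [simp]: "finite (degs n :: ('d::finite \<Rightarrow>\<^sub>0 nat) set)"
proof -
  have "(degs n :: ('d \<Rightarrow>\<^sub>0 nat) set) \<subseteq> midx ` tuples n"
  proof
    fix m :: "'d \<Rightarrow>\<^sub>0 nat"
    assume "m \<in> degs n"
    moreover obtain js where "midx js = m" using midx_surj by blast
    ultimately show "m \<in> midx ` tuples n" by (auto intro!: image_eqI[of _ _ js])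
  qed
  then show ?thesis by (rule finite_subset) simp
qed

section \<open>Hermite expansion and the orthogonal projections\<close>

definition hcoef :: "('d::finite \<Rightarrow>\<^sub>0 nat) \<Rightarrow> 'd cpoly \<Rightarrow> complex" where
  "hcoef m p = hinner (hermite m) p / hsqnorm m"

lemma hcoef_add: "hcoef m (p + q) = hcoef m p + hcoef m q"
  by (simp add: hcoef_def hinner_add_right add_divide_distrib)

lemma hcoef_diff: "hcoef m (p - q) = hcoef m p - hcoef m q"
  by (simp add: hcoef_def hinner_diff_right diff_divide_distrib)

lemma hcoef_scal: "hcoef m (scal c p) = c * hcoef m p"
  by (simp add: hcoef_def hinner_scal_right)

lemma hcoef_sum: "hcoef m (sum f A) = (\<Sum>a\<in>A. hcoef m (f a))"
  by (simp add: hcoef_def hinner_sum_right sum_divide_distrib)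

lemma hcoef_hermite: "hcoef m (hermite l) = (if m = l then 1 else 0)"
  by (simp add: hcoef_def hinner_hermite)

definition hproj :: "nat \<Rightarrow> ('d::finite) cpoly \<Rightarrow> 'd cpoly" where
  "hproj n p = (\<Sum>m\<in>degs n. scal (hcoef m p) (hermite m))"

lemma hproj_add: "hproj n (p + q) = hproj n p + hproj n q"
  by (simp add: hproj_def hcoef_add scal_add_left sum.distrib)

lemma hproj_scal: "hproj n (scal c p) = scal c (hproj n p)"
  by (simp add: hproj_def hcoef_scal scal_sum_right scal_scal)

lemma hproj_0 [simp]: "hproj n 0 = 0"
  using hproj_scal[of n 0 0] by simp

lemma hproj_sum: "hproj n (sum f A) = (\<Sum>a\<in>A. hproj n (f a))"
  by (induction A rule: infinite_finite_induct) (simp_all add: hproj_add)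

lemma hproj_hermite: "hproj n (hermite m) = (if mdegree m = n then hermite m else 0)"
proof -
  have "hproj n (hermite m) = (\<Sum>l\<in>degs n. if l = m then hermite m else 0)"
    unfolding hproj_def by (intro sum.cong refl) (simp add: hcoef_hermite)
  then show ?thesis by simp
qed

text \<open>
  The polynomials of degree at most \<open>n\<close> that equal their Hermite expansion up to degree \<open>n\<close> form
  a linear space. Multiplication by a variable carries it into the corresponding space for \<open>n + 1\<close>,
  by the three-term recurrence, so starting from \<open>1 = hermite 0\<close> it contains every monomial.
\<close>

lemma hermite_expansion:
  assumes "p \<in> polys_upto (int n)"
  shows "p = (\<Sum>k\<le>n. hproj k p)"
proof -
  \<comment> \<open>The expansion up to degree \<open>n\<close> is linear, so it is enough to find its fixed points.\<close>
  define E :: "nat \<Rightarrow> 'a cpoly \<Rightarrow> 'a cpoly" where "E n p = (\<Sum>k\<le>n. hproj k p)" for n p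
  have E_add: "E n (p + q) = E n p + E n q" for n p q
    by (simp add: E_def hproj_add sum.distrib)
  have E_scal: "E n (scal c p) = scal c (E n p)" for n c p
    by (simp add: E_def hproj_scal scal_sum_right)
  have E_sum: "E n (sum f A) = (\<Sum>a\<in>A. E n (f a))" for n A and f :: "'b \<Rightarrow> 'a cpoly"
    unfolding E_def hproj_sum by (rule sum.swap)
  have E_hermite: "E n (hermite m) = hermite m" if "mdegree m \<le> n" for n m
    using that by (simp add: E_def hproj_hermite)
  have E_step: "E (Suc n) (xvar j * hermite m) = xvar j * hermite m" if "mdegree m \<le> n" for n m j
  proof -
    have "mdegree (m - Poly_Mapping.single j 1) \<le> Suc n"
      using that unfolding mdegree_def
      by (intro order.trans[OF sum_mono le_SucI[OF that[unfolded mdegree_def]]])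
        (simp add: lookup_minus)
    with that show ?thesis
      unfolding xvar_mult_hermite by (simp add: E_add E_scal E_hermite)
  qed
  have E_xvar: "E (Suc n) (xvar j * p) = xvar j * p" if "E n p = p" for n p j
  proof -
    have "xvar j * p = xvar j * E n p" using that by simp
    also have "\<dots> = (\<Sum>k\<le>n. \<Sum>m\<in>degs k. scal (hcoef m p) (xvar j * hermite m))"
      by (simp add: E_def hproj_def sum_distrib_left scal_mult_right)
    finally have x: "xvar j * p = \<dots>" .
    show ?thesis
      unfolding x by (simp only: E_sum E_scal) (intro sum.cong refl, simp add: E_step[simplified])
  qed
  have E_monomial: "mdegree m \<le> n \<Longrightarrow> E n (Poly_Mapping.single m 1) = Poly_Mapping.single m 1" for n m
  proof (induction m arbitrary: n rule: multiindex_induct)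
    case zero
    then show ?case using E_hermite[of 0 n] by simp
  next
    case (step l j)
    then obtain n' where n: "n = Suc n'" "mdegree l \<le> n'" by (cases n) auto
    have "Poly_Mapping.single (l + Poly_Mapping.single j 1) 1 = xvar j * Poly_Mapping.single l 1"
      by (simp add: mult_single add.commute)
    then show ?case using E_xvar[OF step.IH[OF n(2)], of j] n(1) by simp
  qed
  have "p = (\<Sum>m\<in>Poly_Mapping.keys p. scal (Poly_Mapping.lookup p m) (Poly_Mapping.single m 1))"
    using cpoly_as_sum[of p] by (simp add: scal_single)
  also have "\<dots> = E n \<dots>"
    using assms by (simp only: E_sum E_scal) (intro sum.cong refl, simp add: polys_upto_def E_monomial)
  finally have "p = E n p"
    using cpoly_as_sum[of p] by (simp add: scal_single)
  then show ?thesis by (simp add: E_def)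
qed

text \<open>
  A polynomial of smaller degree expands in Hermite polynomials of smaller degree. In degree 0 the
  only such polynomial is 0.
\<close>

lemma hinner_hermite_lower:
  assumes "q \<in> polys_upto (int (mdegree m) - 1)"
  shows "hinner q (hermite m) = 0"
proof (cases "mdegree m")
  case 0
  then have "Poly_Mapping.keys q = {}" using assms by (force simp: polys_upto_def)
  then show ?thesis by simp
next
  case (Suc n)
  then have "q = (\<Sum>k\<le>n. \<Sum>l\<in>degs k. scal (hcoef l q) (hermite l))"
    using hermite_expansion[of q n] assms by (simp add: hproj_def)
  then have "hinner q (hermite m)
     = (\<Sum>k\<le>n. \<Sum>l\<in>degs k. cnj (hcoef l q) * hinner (hermite l) (hermite m))"
    by (metis (no_types, lifting) hinner_sum_left hinner_scal_left sum.cong)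
  also have "\<dots> = 0"
    using Suc by (intro sum.neutral ballI) (auto simp: hinner_hermite)
  finally show ?thesis .
qed

lemma hermite_in_ortho: "hermite m \<in> ortho_polys hermite_measure (mdegree m)"
  by (simp add: ortho_polys_def hermite_in_polys_upto hinner_hermite_lower)

lemma ortho_add:
  "p \<in> ortho_polys hermite_measure n \<Longrightarrow> q \<in> ortho_polys hermite_measure n
    \<Longrightarrow> p + q \<in> ortho_polys hermite_measure n"
  by (simp add: ortho_polys_def polys_upto_add hinner_add_right)

lemma ortho_scal:
  "p \<in> ortho_polys hermite_measure n \<Longrightarrow> scal c p \<in> ortho_polys hermite_measure n"
  by (simp add: ortho_polys_def polys_upto_scal hinner_scal_right)

lemma ortho_polys_0: "0 \<in> ortho_polys hermite_measure n"
  by (simp add: ortho_polys_def)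

lemma ortho_sum:
  "(\<And>a. a \<in> A \<Longrightarrow> f a \<in> ortho_polys hermite_measure n)
    \<Longrightarrow> sum f A \<in> ortho_polys hermite_measure n"
  by (induction A rule: infinite_finite_induct) (auto intro: ortho_add simp: ortho_polys_0)

lemma hermite_comb_in_ortho:
  "(\<Sum>m\<in>degs n. scal (c m) (hermite m)) \<in> ortho_polys hermite_measure n"
  by (intro ortho_sum ortho_scal) (use hermite_in_ortho in blast)

text \<open>
  Orthogonality to all lower Hermite polynomials removes the lower part of the expansion.
\<close>

lemma hproj_ortho:
  assumes "p \<in> ortho_polys hermite_measure n"
  shows "hproj n p = p"
proof -
  have low: "hproj k p = 0" if "k < n" for k
  proof -
    have "hcoef m p = 0" if "mdegree m = k" for m
    proof -
      have "hermite m \<in> polys_upto (int n - 1)"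
        using that \<open>k < n\<close> by (intro polys_upto_mono[OF hermite_in_polys_upto]) simp
      with assms show ?thesis by (simp add: ortho_polys_def hcoef_def)
    qed
    then show ?thesis by (simp add: hproj_def)
  qed
  have "p = (\<Sum>k\<le>n. hproj k p)"
    using assms by (intro hermite_expansion) (simp add: ortho_polys_def)
  also have "\<dots> = hproj n p"
    using low by (simp add: lessThan_Suc_atMost[symmetric])
  finally show ?thesis ..
qed

lemma hproj_in_ortho: "hproj n p \<in> ortho_polys hermite_measure n"
  unfolding hproj_def by (rule hermite_comb_in_ortho)

lemma hcoef_hproj: "hcoef m (hproj n p) = (if mdegree m = n then hcoef m p else 0)"
proof -
  have "hcoef m (hproj n p) = (\<Sum>l\<in>degs n. if l = m then hcoef m p else 0)"
    unfolding hproj_def hcoef_sum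
    by (intro sum.cong refl) (simp add: hcoef_scal hcoef_hermite)
  then show ?thesis by simp
qed

text \<open>
  The Hermite polynomials of degree \<open>n\<close> are available as test vectors, so the condition on the
  residual fixes all Hermite coefficients of degree \<open>n\<close>; these determine an element of the \<open>n\<close>-th
  orthogonal space.
\<close>

lemma ortho_proj_eq_hproj: "ortho_proj hermite_measure n p = hproj n p"
  unfolding ortho_proj_def
proof (rule the_equality)
  have "hinner r (p - hproj n p) = 0" if "r \<in> ortho_polys hermite_measure n" for r
  proof -
    have "hinner (hermite m) (p - hproj n p) = 0" if "mdegree m = n" for m
      using hcoef_diff[of m p "hproj n p"] that by (simp add: hcoef_hproj) (simp add: hcoef_def)
    then have "hinner (hproj n r) (p - hproj n p) = 0"
      by (simp add: hproj_def hinner_sum_left hinner_scal_left)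
    then show ?thesis using hproj_ortho[OF that] by simp
  qed
  then show "hproj n p \<in> ortho_polys hermite_measure n
      \<and> (\<forall>r\<in>ortho_polys hermite_measure n. hinner r (p - hproj n p) = 0)"
    by (simp add: hproj_in_ortho)
next
  fix q
  assume q: "q \<in> ortho_polys hermite_measure n
      \<and> (\<forall>r\<in>ortho_polys hermite_measure n. hinner r (p - q) = 0)"
  have "hcoef m q = hcoef m p" if "mdegree m = n" for m
    using q hermite_in_ortho[of m] that hcoef_diff[of m p q] by (simp add: hcoef_def)
  then have "hproj n q = hproj n p" by (simp add: hproj_def)
  then show "q = hproj n p" using q hproj_ortho by metis
qed

section \<open>Creation and preservation operators\<close>

lemma X_lin_mult_hermite:
  "X_lin v * hermite m = (\<Sum>j\<in>UNIV. scal (v $ j) (hermite (m + Poly_Mapping.single j 1)))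
   + (\<Sum>j\<in>UNIV. scal (v $ j * (of_nat (Poly_Mapping.lookup m j) / 2))
        (hermite (m - Poly_Mapping.single j 1)))"
  unfolding X_lin_def sum_distrib_right scal_mult_left xvar_mult_hermite
  by (simp add: scal_add_right scal_scal sum.distrib)

text \<open>
  The lowering part of the recurrence has degree \<open>n - 1\<close>, invisible to projections of degree
  at least \<open>n\<close>. The coefficient stays in the statement because \<open>m - e\<^sub>j\<close> has the wrong degree when
  \<open>m\<^sub>j = 0\<close>, and then it is the coefficient that vanishes.
\<close>

lemma lowering_term_vanishes:
  assumes "mdegree m = n" "k \<ge> n"
  shows "scal (c * (of_nat (Poly_Mapping.lookup m j) / 2))
           (hproj k (hermite (m - Poly_Mapping.single j 1))) = 0"
proof (cases "Poly_Mapping.lookup m j = 0")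
  case False
  then have "m = (m - Poly_Mapping.single j 1) + Poly_Mapping.single j 1"
    by (rule multiindex_minus_add)
  then have "mdegree m = mdegree (m - Poly_Mapping.single j 1) + 1"
    by (metis mdegree_add mdegree_single)
  with assms show ?thesis by (simp add: hproj_hermite)
qed simp

lemma hproj_Suc_X_lin_hermite:
  assumes "mdegree m = n"
  shows "hproj (Suc n) (X_lin v * hermite m)
      = (\<Sum>j\<in>UNIV. scal (v $ j) (hermite (m + Poly_Mapping.single j 1)))"
  using assms unfolding X_lin_mult_hermite hproj_add hproj_sum hproj_scal
  by (simp only: lowering_term_vanishes le_SucI order_refl sum.neutral_const add_0_right)
     (simp add: hproj_hermite)

lemma hproj_X_lin_hermite:
  assumes "mdegree m = n"
  shows "hproj n (X_lin v * hermite m) = 0"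
  using assms unfolding X_lin_mult_hermite hproj_add hproj_sum hproj_scal
  by (simp only: lowering_term_vanishes order_refl sum.neutral_const add_0_right)
     (simp add: hproj_hermite)

lemma hproj_X_lin_hproj: "hproj n (X_lin v * hproj n p) = 0"
  by (simp add: hproj_def[of n p] sum_distrib_left scal_mult_right hproj_sum hproj_scal hproj_X_lin_hermite)

text \<open>
  Multiplication by a linear form changes the degree of a Hermite polynomial by one, so nothing
  is left in the original degree.
\<close>

lemma preservation_eq_0:
  "p \<in> ortho_polys hermite_measure n \<Longrightarrow> preservation hermite_measure v n p = 0"
  by (simp add: preservation_def ortho_proj_eq_hproj hproj_X_lin_hproj)

lemma hproj_eq_0_ortho:
  assumes "p \<in> ortho_polys hermite_measure n" "k \<noteq> n"
  shows "hproj k p = 0"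
proof -
  have "hproj k (hproj n p) = 0"
    using assms(2) by (simp add: hproj_def[of n p] hproj_sum hproj_scal hproj_hermite)
  then show ?thesis using hproj_ortho[OF assms(1)] by simp
qed

text \<open>
  On the \<open>n\<close>-th orthogonal space only the summand with index \<open>n\<close> of the defining sum survives.
\<close>

lemma creation_ortho:
  assumes "p \<in> ortho_polys hermite_measure n"
  shows "creation hermite_measure v p = hproj (Suc n) (X_lin v * p)"
proof -
  have "creation hermite_measure v p
      = Sum_any (\<lambda>k. hproj (Suc n) (X_lin v * p) when k = n)"
    unfolding creation_def ortho_proj_eq_hproj
    by (rule arg_cong[of _ _ Sum_any])
      (auto simp: fun_eq_iff hproj_ortho[OF assms] hproj_eq_0_ortho[OF assms] when_def)
  then show ?thesis by simp
qed

section \<open>Symmetric tensors\<close>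

lemma sum_tuples_permute:
  fixes f :: "'d::finite list \<Rightarrow> 'b::comm_monoid_add"
  assumes "\<pi> permutes {..<n}"
  shows "(\<Sum>js\<in>tuples n. f (permute_list \<pi> js)) = (\<Sum>js\<in>tuples n. f js)"
proof (rule sum.reindex_bij_betw)
  have inv: "inv \<pi> permutes {..<n}" by (rule permutes_inv[OF assms])
  have "permute_list (inv \<pi>) (permute_list \<pi> js) = js"
    and "permute_list \<pi> (permute_list (inv \<pi>) js) = js" if "length js = n" for js :: "'d list"
    using permute_list_compose[of "inv \<pi>" js \<pi>] permute_list_compose[of \<pi> js "inv \<pi>"]
      inv assms that by (simp_all add: permutes_inv_o)
  then show "bij_betw (permute_list \<pi>) (tuples n :: 'd list set) (tuples n)"
    by (intro bij_betw_byWitness[where f' = "permute_list (inv \<pi>)"]) auto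
qed

lemma sum_tuples_Suc:
  "(\<Sum>js\<in>tuples (Suc n). f js) = (\<Sum>j\<in>(UNIV :: 'd::finite set). \<Sum>js\<in>tuples n. f (j # js))"
proof -
  have "bij_betw (\<lambda>(j, js). j # js) ((UNIV :: 'd set) \<times> tuples n) (tuples (Suc n))"
    by (rule bij_betwI[where g = "\<lambda>xs. (hd xs, tl xs)"]) (auto simp: length_Suc_conv)
  from sum.reindex_bij_betw[OF this, of f] show ?thesis
    by (simp add: sum.cartesian_product split_def)
qed

lemma sym_tensors_permute:
  "t \<in> sym_tensors n \<Longrightarrow> length js = n \<Longrightarrow> \<pi> permutes {..<n} \<Longrightarrow> t (permute_list \<pi> js) = t js"
  by (simp add: sym_tensors_def)

lemma sym_tensors_0 [simp]: "0 \<in> sym_tensors n"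
  by (simp add: sym_tensors_def)

lemma sym_tensors_add: "s \<in> sym_tensors n \<Longrightarrow> t \<in> sym_tensors n \<Longrightarrow> s + t \<in> sym_tensors n"
  by (simp add: sym_tensors_def)

lemma sym_tensors_tscal: "t \<in> sym_tensors n \<Longrightarrow> tscal c t \<in> sym_tensors n"
  by (simp add: sym_tensors_def tscal_def)

lemma sym_tensors_sum:
  "(\<And>a. a \<in> A \<Longrightarrow> f a \<in> sym_tensors n) \<Longrightarrow> sum f A \<in> sym_tensors n"
  by (induction A rule: infinite_finite_induct) (auto intro: sym_tensors_add)

lemma tensor_prod_permute_both:
  fixes vs :: "(complex ^ 'd::finite) list"
  assumes "\<sigma> permutes {..<length vs}" "length js = length vs"
  shows "tensor_prod (permute_list \<sigma> vs) (permute_list \<sigma> js) = tensor_prod vs js"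
proof -
  have "(\<Prod>k<length vs. permute_list \<sigma> vs ! k $ (permute_list \<sigma> js ! k))
      = (\<Prod>k<length vs. vs ! \<sigma> k $ (js ! \<sigma> k))"
    using assms by (intro prod.cong refl) (simp add: permute_list_nth)
  also have "\<dots> = (\<Prod>k<length vs. vs ! k $ (js ! k))"
    using prod.permute[OF assms(1), of "\<lambda>k. vs ! k $ (js ! k)"] by (simp add: o_def)
  finally show ?thesis using assms(2) by (simp add: tensor_prod_def)
qed

lemma sym_prod_in_sym_tensors: "sym_prod vs \<in> sym_tensors (length vs)"
proof -
  have "sym_prod vs (permute_list \<sigma> js) = sym_prod vs js"
    if "length js = length vs" and \<sigma>: "\<sigma> permutes {..<length vs}" for js \<sigma>
  proof -
    have "(\<Sum>\<pi> | \<pi> permutes {..<length vs}. tensor_prod (permute_list \<pi> vs) (permute_list \<sigma> js))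
       = (\<Sum>\<pi> | \<pi> permutes {..<length vs}. tensor_prod (permute_list (\<pi> \<circ> \<sigma>) vs) (permute_list \<sigma> js))"
      by (rule sum_permutations_compose_right[OF \<sigma>])
    also have "\<dots> = (\<Sum>\<pi> | \<pi> permutes {..<length vs}. tensor_prod (permute_list \<pi> vs) js)"
      using that by (intro sum.cong refl) (simp add: permute_list_compose tensor_prod_permute_both)
    finally show ?thesis by (simp add: sym_prod_def)
  qed
  then show ?thesis
    by (simp add: sym_tensors_def) (simp add: sym_prod_def tensor_prod_def)
qed

lemma sym_prod_permute:
  assumes "\<sigma> permutes {..<length vs}"
  shows "sym_prod (permute_list \<sigma> vs) = sym_prod vs"
proof
  fix js
  have "(\<Sum>\<pi> | \<pi> permutes {..<length vs}. tensor_prod (permute_list \<pi> (permute_list \<sigma> vs)) js)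
      = (\<Sum>\<pi> | \<pi> permutes {..<length vs}. tensor_prod (permute_list (\<sigma> \<circ> \<pi>) vs) js)"
    by (intro sum.cong refl) (simp add: permute_list_compose)
  also have "\<dots> = (\<Sum>\<pi> | \<pi> permutes {..<length vs}. tensor_prod (permute_list \<pi> vs) js)"
    by (rule setum_permutations_compose_left[OF assms, symmetric])
  finally show "sym_prod (permute_list \<sigma> vs) js = sym_prod vs js"
    by (simp add: sym_prod_def)
qed

definition sym_basis :: "'d::finite list \<Rightarrow> 'd tensor" where
  "sym_basis js = sym_prod (map (\<lambda>j. axis j 1) js)"

lemma sym_basis_in_sym_tensors: "sym_basis js \<in> sym_tensors (length js)"
  using sym_prod_in_sym_tensors[of "map (\<lambda>j. axis j 1) js"] by (simp add: sym_basis_def)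

lemma tensor_prod_axis:
  "tensor_prod (map (\<lambda>j. axis j 1) ks) js = (if ks = js then 1 else 0)"
proof (cases "length ks = length js")
  case True
  show ?thesis
  proof (cases "ks = js")
    case False
    with True obtain k where "k < length ks" "ks ! k \<noteq> js ! k"
      by (meson nth_equalityI)
    with True False show ?thesis
      by (auto simp: tensor_prod_def axis_def intro!: bexI[of _ k])
  qed (simp add: tensor_prod_def axis_def)
qed (auto simp: tensor_prod_def)

lemma sym_basis_eq:
  "sym_basis ks js = 1 / fact (length ks) *
     (\<Sum>\<pi> | \<pi> permutes {..<length ks}. if permute_list \<pi> ks = js then 1 else 0)"
  unfolding sym_basis_def sym_prod_def
  by (simp add: permute_list_map tensor_prod_axis)

lemma card_perms [simp]: "card {\<pi>. \<pi> permutes {..<n::nat}} = fact n"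
  by (simp add: card_permutations[of _ n])

lemma average_over_perms:
  "(\<And>\<pi>. \<pi> permutes {..<n} \<Longrightarrow> f \<pi> = c)
    \<Longrightarrow> 1 / fact n * (\<Sum>\<pi> | \<pi> permutes {..<n::nat}. f \<pi>) = (c :: complex)"
  by simp

text \<open>
  The pairing averages the coordinates of \<open>t\<close> over all rearrangements of \<open>js\<close>, and these coordinates
  agree by symmetry.
\<close>

lemma tensor_inner_sym_basis:
  assumes "t \<in> sym_tensors n" "length js = n"
  shows "tensor_inner n (sym_basis js) t = t js"
proof -
  have "tensor_inner n (sym_basis js) t = 1 / fact n * (\<Sum>\<pi> | \<pi> permutes {..<n}.
      \<Sum>is\<in>tuples n. (if permute_list \<pi> js = is then 1 else 0) * t is)"
  proof -
    have "cnj (sym_basis js is) * t is = 1 / fact n * (\<Sum>\<pi> | \<pi> permutes {..<n}.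
        (if permute_list \<pi> js = is then 1 else 0) * t is)" for "is"
    proof -
      have "cnj (sym_basis js is) = sym_basis js is"
        unfolding sym_basis_eq by (simp add: if_distrib cong: if_cong)
      then show ?thesis
        by (simp only: sym_basis_eq assms(2) sum_distrib_right mult.assoc)
    qed
    then show ?thesis
      unfolding tensor_inner_def by (simp only: sum_distrib_left[symmetric] sum.swap[of _ "tuples n"])
  qed
  also have "\<dots> = t js"
  proof (rule average_over_perms)
    fix \<pi> assume \<pi>: "\<pi> permutes {..<n}"
    have "(\<Sum>is\<in>tuples n. (if permute_list \<pi> js = is then 1 else 0) * t is)
      = (\<Sum>is\<in>tuples n. if is = permute_list \<pi> js then t (permute_list \<pi> js) else 0)"
      by (intro sum.cong refl) auto
    also have "\<dots> = t js"
      using assms sym_tensors_permute[OF assms \<pi>] by simp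
    finally show "(\<Sum>is\<in>tuples n. (if permute_list \<pi> js = is then 1 else 0) * t is) = t js" .
  qed
  finally show ?thesis .
qed

lemma sum_tensor_apply: "(sum f A :: 'd tensor) js = (\<Sum>a\<in>A. f a js)"
  by (induction A rule: infinite_finite_induct) simp_all

text \<open>
  Expanding \<open>t\<close> in tensor powers of the canonical basis and symmetrizing leaves \<open>t\<close> unchanged. The sum
  runs over all tuples, so each basis tensor is repeated, which spares choosing representatives.
\<close>

lemma sym_tensor_expansion:
  fixes t :: "'d::finite tensor"
  assumes "t \<in> sym_tensors n"
  shows "t = (\<Sum>js\<in>tuples n. tscal (t js) (sym_basis js))"
proof
  fix ks
  have "(\<Sum>js\<in>tuples n. tscal (t js) (sym_basis js)) ks
      = (\<Sum>js\<in>tuples n. t js * sym_basis js ks)"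
    by (simp add: sum_tensor_apply tscal_def)
  also have "\<dots> = 1 / fact n * (\<Sum>\<pi> | \<pi> permutes {..<n}.
      \<Sum>js\<in>tuples n. t js * (if permute_list \<pi> js = ks then 1 else 0))"
  proof -
    have "t js * sym_basis js ks = 1 / fact n * (\<Sum>\<pi> | \<pi> permutes {..<n}.
        t js * (if permute_list \<pi> js = ks then 1 else 0))" if "js \<in> tuples n" for js
      using that by (simp only: sym_basis_eq sum_distrib_left mem_Collect_eq mult.left_commute)
    then show ?thesis
      by (simp only: sum_distrib_left[symmetric] sum.swap[of _ "tuples n"] cong: sum.cong)
  qed
  also have "\<dots> = t ks"
  proof (rule average_over_perms)
    fix \<pi> assume \<pi>: "\<pi> permutes {..<n}"
    have "(\<Sum>js\<in>tuples n. t js * (if permute_list \<pi> js = ks then 1 else 0))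
       = (\<Sum>js\<in>tuples n. t (permute_list \<pi> js) * (if permute_list \<pi> js = ks then 1 else 0))"
      using sym_tensors_permute[OF assms _ \<pi>] by (intro sum.cong refl) simp
    also have "\<dots> = (\<Sum>js\<in>tuples n. t js * (if js = ks then 1 else 0))"
      by (rule sum_tuples_permute[OF \<pi>])
    also have "\<dots> = (\<Sum>js\<in>tuples n. if js = ks then t ks else 0)"
      by (intro sum.cong refl) simp
    also have "\<dots> = t ks"
      using assms by (simp add: sym_tensors_def)
    finally show "(\<Sum>js\<in>tuples n. t js * (if permute_list \<pi> js = ks then 1 else 0)) = t ks" .
  qed
  finally show "t ks = (\<Sum>js\<in>tuples n. tscal (t js) (sym_basis js)) ks" ..
qed

lemma linear_map_on_eqI:
  fixes f g :: "'d::finite tensor \<Rightarrow> 'd cpoly"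
  assumes f: "linear_map_on (sym_tensors n) tscal scal f"
    and g: "linear_map_on (sym_tensors n) tscal scal g"
    and basis: "\<And>js. length js = n \<Longrightarrow> f (sym_basis js) = g (sym_basis js)"
    and t: "t \<in> sym_tensors n"
  shows "f t = g t"
proof -
  have "f (\<Sum>js\<in>A. tscal (t js) (sym_basis js)) = g (\<Sum>js\<in>A. tscal (t js) (sym_basis js))"
    if "A \<subseteq> tuples n" for A
    using finite_subset[OF that finite_tuples] that
  proof (induction A rule: finite_induct)
    case empty
    have "tscal 0 0 = (0 :: 'd tensor)"
      by (simp add: tscal_def zero_fun_def)
    then have "f 0 = 0" "g 0 = 0"
      using f g sym_tensors_0[of n] unfolding linear_map_on_def by (metis scal_0)+
    then show ?case by (simp only: sum.empty)
  next
    case (insert js A)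
    have s: "sym_basis ks \<in> sym_tensors n" if "ks \<in> insert js A" for ks
      using sym_basis_in_sym_tensors[of ks] insert.prems that by auto
    let ?x = "sym_basis js" and ?y = "\<Sum>ks\<in>A. tscal (t ks) (sym_basis ks)"
    have x: "?x \<in> sym_tensors n" and y: "?y \<in> sym_tensors n"
      using s by (auto intro!: sym_tensors_tscal sym_tensors_sum)
    have "h (tscal (t js) ?x + ?y) = scal (t js) (h ?x) + h ?y"
      if "linear_map_on (sym_tensors n) tscal scal h" for h :: "'d tensor \<Rightarrow> 'd cpoly"
      using that x y sym_tensors_tscal[OF x] by (simp only: linear_map_on_def)
    from this[OF f] this[OF g] have "f (tscal (t js) ?x + ?y) = g (tscal (t js) ?x + ?y)"
      using insert.IH insert.prems basis[of js] by simp
    moreover have "(\<Sum>ks\<in>insert js A. tscal (t ks) (sym_basis ks)) = tscal (t js) ?x + ?y"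
      by (rule sum.insert[OF insert.hyps])
    ultimately show ?case by (rule back_subst[of "\<lambda>x. f x = g x", OF _ sym])
  qed
  from this[OF order_refl] show ?thesis
    by (simp only: sym_tensor_expansion[OF t, symmetric])
qed

section \<open>The isomorphism onto the orthogonal polynomials\<close>

text \<open>
  The explicit form of \<open>U\<^sub>n\<close>. It makes sense on all tensors, not only symmetric ones, which allows an
  induction along \<open>v # vs\<close> with unsymmetrized products in \<open>foldr_creation\<close>.
\<close>

definition hermite_map :: "nat \<Rightarrow> 'd::finite tensor \<Rightarrow> 'd cpoly" where
  "hermite_map n t = (\<Sum>js\<in>tuples n. scal (t js) (hermite (midx js)))"

lemma hermite_map_add: "hermite_map n (s + t) = hermite_map n s + hermite_map n t"
  by (simp add: hermite_map_def scal_add_left sum.distrib)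

lemma hermite_map_tscal: "hermite_map n (tscal c t) = scal c (hermite_map n t)"
  by (simp add: hermite_map_def tscal_def scal_sum_right scal_scal)

lemma hermite_map_in_ortho: "hermite_map n t \<in> ortho_polys hermite_measure n"
  unfolding hermite_map_def
  by (intro ortho_sum ortho_scal) (metis hermite_in_ortho mdegree_midx mem_Collect_eq)

text \<open>
  \<open>midx\<close> forgets the order of a tuple, so permuting the factors of a product does not change its
  image, and averaging over permutations does not either.
\<close>

lemma hermite_map_sym_prod:
  assumes "length vs = n"
  shows "hermite_map n (sym_prod vs) = hermite_map n (tensor_prod vs)"
proof -
  have perm: "hermite_map n (tensor_prod (permute_list \<pi> vs)) = hermite_map n (tensor_prod vs)"
    if \<pi>: "\<pi> permutes {..<n}" for \<pi>
  proof -
    have "hermite_map n (tensor_prod (permute_list \<pi> vs)) = (\<Sum>js\<in>tuples n.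
        scal (tensor_prod (permute_list \<pi> vs) (permute_list \<pi> js)) (hermite (midx (permute_list \<pi> js))))"
      unfolding hermite_map_def by (rule sum_tuples_permute[OF \<pi>, symmetric])
    also have "\<dots> = hermite_map n (tensor_prod vs)"
      unfolding hermite_map_def using assms \<pi>
      by (intro sum.cong refl) (simp add: tensor_prod_permute_both midx_permute_list)
    finally show ?thesis .
  qed
  have "hermite_map n (sym_prod vs)
      = (\<Sum>\<pi> | \<pi> permutes {..<n}. scal (1 / fact n) (hermite_map n (tensor_prod (permute_list \<pi> vs))))"
    unfolding hermite_map_def sym_prod_def assms scal_sum_right scal_scal sum_distrib_left scal_sum_left
    by (rule sum.swap)
  also have "\<dots> = (\<Sum>\<pi> | \<pi> permutes {..<n}. scal (1 / fact n) (hermite_map n (tensor_prod vs)))"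
    by (intro sum.cong refl) (simp add: perm)
  also have "\<dots> = scal (\<Sum>\<pi> | \<pi> permutes {..<n}. 1 / fact n) (hermite_map n (tensor_prod vs))"
    by (simp only: scal_sum_left)
  finally show ?thesis by simp
qed

text \<open>
  Creation with \<open>v\<close> replaces \<open>hermite (midx js)\<close> by the combination of the polynomials
  \<open>hermite (midx (j # js))\<close> with weights \<open>v\<^sub>j\<close>, which matches prefixing the factor \<open>v\<close> to a tensor
  product.
\<close>

lemma foldr_creation:
  "foldr (creation hermite_measure) vs 1 = hermite_map (length vs) (tensor_prod vs)"
proof (induction vs)
  case Nil
  have "tuples 0 = {[]}" by auto
  then show ?case by (simp add: hermite_map_def tensor_prod_def)
next
  case (Cons v vs)
  let ?n = "length vs"
  have "foldr (creation hermite_measure) (v # vs) 1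
      = hproj (Suc ?n) (X_lin v * hermite_map ?n (tensor_prod vs))"
    using Cons by (simp add: creation_ortho[OF hermite_map_in_ortho])
  also have "\<dots> = (\<Sum>js\<in>tuples ?n. \<Sum>j\<in>UNIV.
      scal (tensor_prod vs js * v $ j) (hermite (midx (j # js))))"
    by (simp add: hermite_map_def sum_distrib_left scal_mult_right hproj_sum hproj_scal
        hproj_Suc_X_lin_hermite[simplified] scal_sum_right scal_scal)
  also have "\<dots> = (\<Sum>j\<in>UNIV. \<Sum>js\<in>tuples ?n.
      scal (tensor_prod (v # vs) (j # js)) (hermite (midx (j # js))))"
    by (subst sum.swap, intro sum.cong refl)
      (simp add: tensor_prod_def prod.lessThan_Suc_shift mult_ac del: prod.lessThan_Suc)
  also have "\<dots> = hermite_map (length (v # vs)) (tensor_prod (v # vs))"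
    by (simp add: hermite_map_def sum_tuples_Suc)
  finally show ?case .
qed

lemma hermite_map_sym_basis:
  assumes "length js = n"
  shows "hermite_map n (sym_basis js) = hermite (midx js)"
proof -
  have "hermite_map n (sym_basis js)
      = (\<Sum>ks\<in>tuples n. if ks = js then hermite (midx js) else 0)"
    unfolding sym_basis_def using assms
    by (subst hermite_map_sym_prod, simp, unfold hermite_map_def, intro sum.cong refl)
      (simp add: tensor_prod_axis)
  then show ?thesis using assms by simp
qed

text \<open>
  All rearrangements of \<open>js\<close> contribute the same coordinate of a symmetric tensor. This gives
  injectivity of \<open>hermite_map\<close>, and its preimages are found by dividing by the number of
  rearrangements.
\<close>

lemma hcoef_hermite_map:
  assumes t: "t \<in> sym_tensors n" and js: "length js = n"
  shows "hcoef (midx js) (hermite_map n t) = of_nat (card {is. midx is = midx js}) * t js"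
proof -
  have len: "length is = n" if "midx is = midx js" for "is"
    using that js by (metis mdegree_midx)
  have t_eq: "t is = t js" if "midx is = midx js" for "is"
  proof -
    have "mset is = mset js" using that by (simp add: midx_eq_iff)
    then obtain \<pi> where "\<pi> permutes {..<length js}" "permute_list \<pi> js = is"
      by (rule mset_eq_permutation)
    with t js show ?thesis by (metis sym_tensors_permute)
  qed
  have "hcoef (midx js) (scal (t is) (hermite (midx is)))
      = (if midx is = midx js then t js else 0)" for "is"
    using t_eq[of "is"] by (cases "midx is = midx js") (simp_all add: hcoef_scal hcoef_hermite)
  then have "hcoef (midx js) (hermite_map n t)
      = (\<Sum>is\<in>tuples n. if midx is = midx js then t js else 0)"
    unfolding hermite_map_def hcoef_sum by (simp only:)
  also have "\<dots> = (\<Sum>is | midx is = midx js. t js)"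
    by (rule sum.mono_neutral_cong_right) (auto simp: len)
  finally show ?thesis by simp
qed

lemma finite_midx_fibre: "finite {is. midx is = (m :: 'd::finite \<Rightarrow>\<^sub>0 nat)}"
  by (rule finite_subset[of _ "tuples (mdegree m)"]) auto

lemma bij_betw_hermite_map:
  "bij_betw (hermite_map n) (sym_tensors n) (ortho_polys hermite_measure n :: 'd::finite cpoly set)"
proof (rule bij_betwI')
  fix s t :: "'d tensor"
  assume s: "s \<in> sym_tensors n" and t: "t \<in> sym_tensors n"
  show "(hermite_map n s = hermite_map n t) = (s = t)"
  proof
    assume eq: "hermite_map n s = hermite_map n t"
    show "s = t"
    proof
      fix js :: "'d list"
      show "s js = t js"
      proof (cases "length js = n")
        case True
        have "card {is. midx is = midx js} \<noteq> 0"
          using finite_midx_fibre[of "midx js"] by auto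
        then show ?thesis
          using hcoef_hermite_map[OF s True] hcoef_hermite_map[OF t True] eq by simp
      qed (use s t in \<open>simp add: sym_tensors_def\<close>)
    qed
  qed simp
next
  fix p :: "'d cpoly"
  assume p: "p \<in> ortho_polys hermite_measure n"
  \<comment> \<open>Each coefficient is spread evenly over the tuples with the given multi-index.\<close>
  define t :: "'d tensor" where "t js = (if length js = n
      then hcoef (midx js) p / of_nat (card {is. midx is = midx js}) else 0)" for js
  have "t \<in> sym_tensors n"
    by (auto simp: sym_tensors_def t_def midx_permute_list)
  moreover have "hermite_map n t = p"
  proof -
    have "hermite_map n t = (\<Sum>m\<in>degs n. \<Sum>js\<in>{js \<in> tuples n. midx js = m}.
        scal (t js) (hermite (midx js)))"
      unfolding hermite_map_def by (rule sum.group[symmetric]) auto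
    also have "\<dots> = (\<Sum>m\<in>degs n. scal (hcoef m p) (hermite m))"
    proof (intro sum.cong refl)
      fix m :: "'d \<Rightarrow>\<^sub>0 nat" assume m: "m \<in> degs n"
      let ?F = "{is. midx is = m}"
      have F: "{js \<in> tuples n. midx js = m} = ?F" using m by auto
      have "card ?F \<noteq> 0" using finite_midx_fibre[of m] midx_surj[of m] by auto
      have "(\<Sum>js\<in>?F. scal (t js) (hermite (midx js)))
          = (\<Sum>js\<in>?F. scal (hcoef m p / of_nat (card ?F)) (hermite m))"
        using m by (intro sum.cong refl) (auto simp: t_def)
      also have "\<dots> = scal (hcoef m p) (hermite m)"
        using \<open>card ?F \<noteq> 0\<close> by (simp only: scal_sum_left[symmetric]) simp
      finally show "(\<Sum>js\<in>{js \<in> tuples n. midx js = m}. scal (t js) (hermite (midx js)))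
          = scal (hcoef m p) (hermite m)" by (simp only: F)
    qed
    also have "\<dots> = p" using hproj_ortho[OF p] by (simp add: hproj_def)
    finally show ?thesis .
  qed
  ultimately show "\<exists>t\<in>sym_tensors n. p = hermite_map n t" by blast
qed (rule hermite_map_in_ortho)

lemma linear_hermite_map: "linear_map_on (sym_tensors n) tscal scal (hermite_map n)"
  by (simp add: linear_map_on_def hermite_map_add hermite_map_tscal)

lemma linear_map_on_cong:
  assumes eq: "\<And>t. t \<in> sym_tensors n \<Longrightarrow> f t = g t"
    and g: "linear_map_on (sym_tensors n) tscal sb g"
  shows "linear_map_on (sym_tensors n) tscal sb f"
  unfolding linear_map_on_def
proof (intro conjI ballI allI)
  fix x y :: "'a tensor"
  assume x: "x \<in> sym_tensors n" and y: "y \<in> sym_tensors n"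
  have "g (x + y) = g x + g y" using g x y by (simp only: linear_map_on_def)
  then show "f (x + y) = f x + f y" by (simp only: eq x y sym_tensors_add)
next
  fix c and x :: "'a tensor"
  assume x: "x \<in> sym_tensors n"
  have "g (tscal c x) = sb c (g x)" using g x by (simp only: linear_map_on_def)
  then show "f (tscal c x) = sb c (f x)" by (simp only: eq x sym_tensors_tscal)
qed

lemma U_iso_hermite: "U_iso hermite_measure n = restrict (hermite_map n) (sym_tensors n)"
  unfolding U_iso_def
proof (rule the_equality, intro conjI)
  show "restrict (hermite_map n) (sym_tensors n) \<in> extensional (sym_tensors n)" by simp
  show "linear_map_on (sym_tensors n) tscal scal (restrict (hermite_map n) (sym_tensors n))"
    by (rule linear_map_on_cong[OF _ linear_hermite_map]) simp
  show "bij_betw (restrict (hermite_map n) (sym_tensors n)) (sym_tensors n) (ortho_polys hermite_measure n)"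
    using bij_betw_hermite_map by (simp cong: bij_betw_cong)
  show "\<forall>vs. length vs = n \<longrightarrow> restrict (hermite_map n) (sym_tensors n) (sym_prod vs)
      = foldr (creation hermite_measure) vs 1"
    using sym_prod_in_sym_tensors by (auto simp: foldr_creation hermite_map_sym_prod)
next
  fix U :: "'a tensor \<Rightarrow> 'a cpoly"
  assume U: "U \<in> extensional (sym_tensors n) \<and>
     linear_map_on (sym_tensors n) tscal scal U \<and>
     bij_betw U (sym_tensors n) (ortho_polys hermite_measure n) \<and>
     (\<forall>vs. length vs = n \<longrightarrow> U (sym_prod vs) = foldr (creation hermite_measure) vs 1)"
  have "U t = hermite_map n t" if t: "t \<in> sym_tensors n" for t
  proof (rule linear_map_on_eqI[OF _ linear_hermite_map _ t])
    show "linear_map_on (sym_tensors n) tscal scal U" using U by blast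
    fix js :: "'a list" assume "length js = n"
    with U show "U (sym_basis js) = hermite_map n (sym_basis js)"
      by (simp add: sym_basis_def foldr_creation hermite_map_sym_prod)
  qed
  with U show "U = restrict (hermite_map n) (sym_tensors n)"
    by (intro extensionalityI[of _ "sym_tensors n"]) auto
qed

lemma U_iso_apply: "t \<in> sym_tensors n \<Longrightarrow> U_iso hermite_measure n t = hermite_map n t"
  by (simp add: U_iso_hermite)

section \<open>The Jacobi sequences\<close>

lemma jacobi_alpha_hermite:
  fixes t :: "'d::finite tensor"
  assumes t: "t \<in> sym_tensors n"
  shows "jacobi_alpha hermite_measure v n t = 0"
proof -
  let ?U = "U_iso hermite_measure n :: 'd tensor \<Rightarrow> 'd cpoly"
  have "preservation hermite_measure v n (?U t) = 0"
    using t by (simp add: U_iso_apply preservation_eq_0 hermite_map_in_ortho)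
  moreover have "?U 0 = 0"
    by (simp add: U_iso_apply hermite_map_def)
  moreover have "bij_betw ?U (sym_tensors n) (ortho_polys hermite_measure n)"
    unfolding U_iso_hermite using bij_betw_hermite_map by (simp cong: bij_betw_cong)
  then have "inj_on ?U (sym_tensors n)"
    by (rule bij_betw_imp_inj_on)
  ultimately have "inv_into (sym_tensors n) ?U (preservation hermite_measure v n (?U t)) = 0"
    by (metis inv_into_f_eq sym_tensors_0)
  then show ?thesis using t by (simp add: jacobi_alpha_def)
qed

text \<open>
  The explicit form of \<open>\<Omega>\<^sub>n\<close>. Its values are symmetric tensors because the kernel depends on the
  tuple only through its multi-index.
\<close>

definition gram_op :: "nat \<Rightarrow> 'd::finite tensor \<Rightarrow> 'd tensor" where
  "gram_op n t = (\<lambda>is. if length is = n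
     then \<Sum>js\<in>tuples n. hinner (hermite (midx is)) (hermite (midx js)) * t js else 0)"

lemma gram_op_in_sym_tensors: "gram_op n t \<in> sym_tensors n"
  by (auto simp: sym_tensors_def gram_op_def midx_permute_list)

lemma tensor_inner_gram_op:
  "tensor_inner n s (gram_op n t) = hinner (hermite_map n s) (hermite_map n t)"
  by (simp add: tensor_inner_def gram_op_def hermite_map_def hinner_sum_left hinner_sum_right
      hinner_scal_left hinner_scal_right sum_distrib_left mult_ac) (rule sum.swap)

text \<open>
  Pairing with the symmetrized basis tensors shows that the defining identity determines every
  coordinate of \<open>\<Omega>\<^sub>n t\<close>.
\<close>

lemma jacobi_Omega_hermite:
  "jacobi_Omega hermite_measure n = restrict (gram_op n) (sym_tensors n)"
  unfolding jacobi_Omega_def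
proof (rule the_equality, intro conjI)
  show "restrict (gram_op n) (sym_tensors n) \<in> extensional (sym_tensors n)" by simp
  show "restrict (gram_op n) (sym_tensors n) ` sym_tensors n \<subseteq> sym_tensors n"
    using gram_op_in_sym_tensors by auto
  show "linear_map_on (sym_tensors n) tscal tscal (restrict (gram_op n) (sym_tensors n))"
    by (rule linear_map_on_cong[where g = "gram_op n"], simp)
      (auto simp: linear_map_on_def gram_op_def tscal_def fun_eq_iff distrib_left distrib_right sum.distrib
        sum_distrib_left mult_ac)
  show "\<forall>\<xi>\<in>sym_tensors n. \<forall>\<eta>\<in>sym_tensors n.
      tensor_inner n \<xi> (restrict (gram_op n) (sym_tensors n) \<eta>)
        = hinner (U_iso hermite_measure n \<xi>) (U_iso hermite_measure n \<eta>)"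
    by (simp add: tensor_inner_gram_op U_iso_apply)
next
  fix \<Omega> :: "'a tensor \<Rightarrow> 'a tensor"
  assume \<Omega>: "\<Omega> \<in> extensional (sym_tensors n) \<and>
     \<Omega> ` sym_tensors n \<subseteq> sym_tensors n \<and>
     linear_map_on (sym_tensors n) tscal tscal \<Omega> \<and>
     (\<forall>\<xi>\<in>sym_tensors n. \<forall>\<eta>\<in>sym_tensors n. tensor_inner n \<xi> (\<Omega> \<eta>)
        = hinner (U_iso hermite_measure n \<xi>) (U_iso hermite_measure n \<eta>))"
  have "\<Omega> t = gram_op n t" if t: "t \<in> sym_tensors n" for t
  proof
    fix js :: "'a list"
    have \<Omega>t: "\<Omega> t \<in> sym_tensors n" using \<Omega> t by auto
    show "\<Omega> t js = gram_op n t js"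
    proof (cases "length js = n")
      case True
      have s: "sym_basis js \<in> sym_tensors n" using sym_basis_in_sym_tensors True by blast
      have "tensor_inner n (sym_basis js) (\<Omega> t) = tensor_inner n (sym_basis js) (gram_op n t)"
        using \<Omega> s t by (simp add: tensor_inner_gram_op U_iso_apply)
      then show ?thesis
        by (simp add: tensor_inner_sym_basis True \<Omega>t gram_op_in_sym_tensors)
    qed (use \<Omega>t in \<open>simp add: sym_tensors_def gram_op_def\<close>)
  qed
  with \<Omega> show "\<Omega> = restrict (gram_op n) (sym_tensors n)"
    by (intro extensionalityI[of _ "sym_tensors n"]) auto
qed

lemma occ_eq_count: "occ js l = count (mset js) l"
proof -
  have "occ js l = length (filter (\<lambda>x. x = l) js)"
    by (simp add: occ_def length_filter_conv_card)
  moreover have "(\<lambda>x. x = l) = (=) l" by auto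
  ultimately show ?thesis
    by (simp only: count_mset count_list_eq_length_filter)
qed

lemma mem_cl_iff: "is \<in> cl js \<longleftrightarrow> mset is = mset js"
  by (simp add: cl_def occ_eq_count flip: multiset_eq_iff) (metis mset_eq_length)

text \<open>
  Classes of tuples, multisets of indices and multi-indices carry the same information.
\<close>

lemma cl_eq_iff: "cl is = cl js \<longleftrightarrow> midx is = midx js"
  by (metis mem_cl_iff midx_eq_iff set_eqI)

lemma e_cl_eq: "e_cl (cl js) = sym_basis js"
proof -
  have "sym_basis is = sym_basis js" if "is \<in> cl js" for "is"
  proof -
    have "mset is = mset js" using that by (simp add: mem_cl_iff)
    then obtain \<pi> where "\<pi> permutes {..<length js}" "permute_list \<pi> js = is"
      by (rule mset_eq_permutation)
    then show ?thesis
      by (metis sym_basis_def sym_prod_permute permute_list_map length_map)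
  qed
  then have "sym_basis ` cl js = (\<lambda>_. sym_basis js) ` cl js"
    by (intro image_cong refl)
  also have "\<dots> = {sym_basis js}"
    by (rule image_constant[of js]) (simp add: mem_cl_iff)
  finally show ?thesis
    by (simp only: e_cl_def sym_basis_def[symmetric] the_elem_eq)
qed

lemma hsqnorm_midx:
  "hsqnorm (midx (is :: 'd::finite list)) = (1 / 2) ^ (\<Sum>l\<in>UNIV. occ is l)
     * complex_of_real (pi powr (real CARD('d) / 2)) * (\<Prod>l\<in>UNIV. fact (occ is l))"
proof -
  have "pi powr (real CARD('d) / 2) = (pi powr (1 / 2)) powr real CARD('d)"
    by (simp add: powr_powr)
  also have "\<dots> = sqrt pi ^ CARD('d)"
    by (simp add: powr_half_sqrt powr_realpow)
  finally show ?thesis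
    by (simp add: hsqnorm_def lookup_midx occ_eq_count prod.distrib prod_dividef power_sum
        power_divide mult_ac)
qed

theorem theorem4p2:
  fixes \<mu> :: "(real ^ 'd::finite) measure"
  assumes "\<mu> = hermite_measure"
  shows "\<forall>n::nat.
     (\<forall>v. \<forall>\<xi>\<in>sym_tensors n. jacobi_alpha \<mu> v n \<xi> = 0) \<and>
     (\<forall>(is::'d list) js. length is = n \<and> length js = n \<longrightarrow>
        Omega_coeff \<mu> n (cl is) (cl js) =
          (if cl is = cl js then 1 else 0)
          * (1 / 2) ^ (\<Sum>l\<in>UNIV. occ is l)
          * complex_of_real (pi powr (real CARD('d) / 2))
          * (\<Prod>l\<in>UNIV. fact (occ is l)))"
proof (intro allI conjI ballI impI)
  show "jacobi_alpha \<mu> v n \<xi> = 0" if "\<xi> \<in> sym_tensors n" for v n \<xi>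
    using that by (simp add: assms jacobi_alpha_hermite)
next
  fix n and "is" js :: "'d list"
  assume len: "length is = n \<and> length js = n"
  then have "sym_basis is \<in> sym_tensors n" "sym_basis js \<in> sym_tensors n"
    by (metis sym_basis_in_sym_tensors)+
  then have "Omega_coeff \<mu> n (cl is) (cl js) = hinner (hermite (midx is)) (hermite (midx js))"
    using len by (simp add: Omega_coeff_def e_cl_eq assms jacobi_Omega_hermite
        tensor_inner_gram_op hermite_map_sym_basis)
  then show "Omega_coeff \<mu> n (cl is) (cl js) =
          (if cl is = cl js then 1 else 0)
          * (1 / 2) ^ (\<Sum>l\<in>UNIV. occ is l)
          * complex_of_real (pi powr (real CARD('d) / 2))
          * (\<Prod>l\<in>UNIV. fact (occ is l))"
    by (simp only: hinner_hermite cl_eq_iff hsqnorm_midx[of "is"] split: if_split) simp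
qed

end
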